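(* Let $N\ge2$ and let $\mathbf 1_N$ be the $N\times N$ matrix with all entries equal to $1$. For any $\ell\in\mathbb N\cup\{\infty\}$, $\mathbb G_{\mathbf 1_N}^\ell=H_N^{[\ell]+}$; that is, there is a $*$-isomorphism $C(\mathbb G_{\mathbf 1_N}^\ell)\to C(H_N^{[\ell]+})$ mapping the generator $u_{ij}$ to the generator $v_{ij}$ for all $1\le i,j\le N$ (hence intertwining the coproducts).
   Context: A magic unitary is a square matrix of projections in a unital $C^*$-algebra with all rows and columns summing to $1$. $C(\mathbb G_{\mathbf 1_N}^\ell)$ is the universal unital $C^*$-algebra generated by partial isometries $(u_{ij})_{1\le i,j\le N}$ such that, with $p_{ij}=u_{ij}u_{ij}^*$, $q_{ij}=u_{ij}^*u_{ij}$: (I) $p=(p_{ij})$, $q=(q_{ij})$ are magic unitaries preserving the (constant) Perron--Frobenius eigenvector of $\mathbf 1_N$; (II) $\mathbf 1_Np=q\mathbf 1_N$; (III) for all finite $n\le\ell$ and all $i_1,\dots,i_n,j_1,\dots,j_n\in\{1,\dots,N\}$, $u_{i_1j_1}\cdots u_{i_nj_n}$ is a partial isometry. Its coproduct is $u_{ij}\mapsto\sum_ku_{ik}\otimes u_{kj}$. $H_N^{[\ell]+}$ is the hyperoctahedral unitary easy quantum group (from A. Mang's thesis) associated with the parameter set $R_\ell=\{\circ^k,\bullet^k: 1\le k\le\ell,\ k\in\mathbb N\}$. Concretely, $C(H_N^{[\ell]+})$ is the universal unital $C^*$-algebra generated by $(v_{ij})_{1\le i,j\le N}$ such that the matrices $v=(v_{ij})$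 and $\overline v=(v_{ij}^* )$ are unitary and, for every finite $1\le k\le\ell$ and all multi-indices $\mathbf i,\mathbf j,\mathbf s,\mathbf t\in\{1,\dots,N\}^k$, $$\delta_{\mathbf j,\mathbf t}\,v_{i_1j_1}\cdots v_{i_kj_k}v_{s_kt_k}^*\cdots v_{s_1t_1}^*=\delta_{\mathbf i,\mathbf s}\,v_{i_1j_1}\cdots v_{i_kj_k}v_{s_kt_k}^*\cdots v_{s_1t_1}^*$$ (the relation attached to $\circ^k$), together with the same relation in which every $v_{ab}$ is replaced by $v_{ab}^*$ and vice versa (the relation attached to $\bullet^k$). Its coproduct is $v_{ij}\mapsto\sum_kv_{ik}\otimes v_{kj}$. *)

theory Defs
  imports "HOL-Analysis.Analysis" "HOL-Algebra.Module" "HOL-Library.Extended_Nat"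
begin

section \<open>Unital C*-algebras\<close>

text \<open>
  A universal property quantifies over all C*-algebras inside a formula, so C*-algebras are
  records with a carrier set in the style of HOL-Algebra, not type classes. The locale
  \<open>module\<close> is not used because it needs the scalars as a ring record; here the scalars
  are the type \<open>complex\<close>. The zero algebra is allowed.
\<close>

record 'a cstar = "(complex, 'a) module" +
  star :: "'a \<Rightarrow> 'a"
  nrm :: "'a \<Rightarrow> real"

locale unital_cstar_algebra = ring A for A :: "'a cstar" (structure) +
  assumes smult_closed: "x \<in> carrier A \<Longrightarrow> c \<odot> x \<in> carrier A"
    and smult_l_distr: "x \<in> carrier A \<Longrightarrow> (c + d) \<odot> x = c \<odot> x \<oplus> d \<odot> x"
    and smult_r_distr:
      "x \<in> carrier A \<Longrightarrow> y \<in> carrier A \<Longrightarrow> c \<odot> (x \<oplus> y) = c \<odot> x \<oplus> c \<odot> y"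
    and smult_assoc: "x \<in> carrier A \<Longrightarrow> (c * d) \<odot> x = c \<odot> (d \<odot> x)"
    and smult_one: "x \<in> carrier A \<Longrightarrow> (1::complex) \<odot> x = x"
    and smult_mult_left:
      "x \<in> carrier A \<Longrightarrow> y \<in> carrier A \<Longrightarrow> (c \<odot> x) \<otimes> y = c \<odot> (x \<otimes> y)"
    and smult_mult_right:
      "x \<in> carrier A \<Longrightarrow> y \<in> carrier A \<Longrightarrow> x \<otimes> (c \<odot> y) = c \<odot> (x \<otimes> y)"
    and star_closed: "x \<in> carrier A \<Longrightarrow> star A x \<in> carrier A"
    and star_star: "x \<in> carrier A \<Longrightarrow> star A (star A x) = x"
    and star_add:
      "x \<in> carrier A \<Longrightarrow> y \<in> carrier A \<Longrightarrow> star A (x \<oplus> y) = star A x \<oplus> star A y"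
    and star_smult: "x \<in> carrier A \<Longrightarrow> star A (c \<odot> x) = cnj c \<odot> star A x"
    and star_mult:
      "x \<in> carrier A \<Longrightarrow> y \<in> carrier A \<Longrightarrow> star A (x \<otimes> y) = star A y \<otimes> star A x"
    and nrm_nonneg: "x \<in> carrier A \<Longrightarrow> 0 \<le> nrm A x"
    and nrm_eq_zero: "x \<in> carrier A \<Longrightarrow> nrm A x = 0 \<longleftrightarrow> x = \<zero>"
    and nrm_triangle:
      "x \<in> carrier A \<Longrightarrow> y \<in> carrier A \<Longrightarrow> nrm A (x \<oplus> y) \<le> nrm A x + nrm A y"
    and nrm_smult: "x \<in> carrier A \<Longrightarrow> nrm A (c \<odot> x) = cmod c * nrm A x"
    and nrm_mult:
      "x \<in> carrier A \<Longrightarrow> y \<in> carrier A \<Longrightarrow> nrm A (x \<otimes> y) \<le> nrm A x * nrm A y"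
    and cstar_identity: "x \<in> carrier A \<Longrightarrow> nrm A (star A x \<otimes> x) = (nrm A x)\<^sup>2"
    and nrm_complete:
      "(\<And>n::nat. X n \<in> carrier A) \<Longrightarrow>
       (\<And>e. e > 0 \<Longrightarrow> \<exists>M. \<forall>m\<ge>M. \<forall>n\<ge>M. nrm A (X m \<ominus> X n) < e) \<Longrightarrow>
       \<exists>x\<in>carrier A. (\<lambda>n. nrm A (X n \<ominus> x)) \<longlonglongrightarrow> 0"

definition star_hom :: "'a cstar \<Rightarrow> 'a cstar \<Rightarrow> ('a \<Rightarrow> 'a) \<Rightarrow> bool" where
  "star_hom A B \<phi> \<longleftrightarrow> \<phi> \<in> ring_hom A B \<and>
     (\<forall>c. \<forall>x\<in>carrier A. \<phi> (c \<odot>\<^bsub>A\<^esub> x) = c \<odot>\<^bsub>B\<^esub> \<phi> x) \<and>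
     (\<forall>x\<in>carrier A. \<phi> (star A x) = star B (\<phi> x))"

definition star_iso :: "'a cstar \<Rightarrow> 'a cstar \<Rightarrow> ('a \<Rightarrow> 'a) \<Rightarrow> bool" where
  "star_iso A B \<phi> \<longleftrightarrow> star_hom A B \<phi> \<and> bij_betw \<phi> (carrier A) (carrier B)"

definition projection :: "'a cstar \<Rightarrow> 'a \<Rightarrow> bool" where
  "projection A x \<longleftrightarrow> x \<in> carrier A \<and> star A x = x \<and> x \<otimes>\<^bsub>A\<^esub> x = x"

definition partial_isometry :: "'a cstar \<Rightarrow> 'a \<Rightarrow> bool" where
  "partial_isometry A x \<longleftrightarrow> x \<in> carrier A \<and> x \<otimes>\<^bsub>A\<^esub> star A x \<otimes>\<^bsub>A\<^esub> x = x"

definition prod_word :: "'a cstar \<Rightarrow> 'a list \<Rightarrow> 'a" where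
  "prod_word A xs = foldr (\<lambda>x y. x \<otimes>\<^bsub>A\<^esub> y) xs \<one>\<^bsub>A\<^esub>"


section \<open>Universal C*-algebras given by generators and relations\<close>

text \<open>
  The generators form an \<open>N \<times> N\<close> matrix, that is, a function on pairs of indices
  whose values outside \<open>{1..N}\<close> are irrelevant. \<open>R A u\<close> says that \<open>u\<close> satisfies
  the relations in \<open>A\<close>.
\<close>

definition matrix_in :: "nat \<Rightarrow> 'a cstar \<Rightarrow> (nat \<Rightarrow> nat \<Rightarrow> 'a) \<Rightarrow> bool" where
  "matrix_in N A u \<longleftrightarrow> (\<forall>i\<in>{1..N}. \<forall>j\<in>{1..N}. u i j \<in> carrier A)"

text \<open>
  \<open>A\<close> is the universal unital C*-algebra generated by the \<open>u i j\<close> subject to \<open>R\<close>. The test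
  algebras \<open>B\<close> range over the C*-algebras carried by subsets of the (arbitrary) type
  \<open>'a\<close>. If \<open>'a\<close> has at least the cardinality of the continuum, this is the full universal
  property, because a C*-algebra generated by finitely many elements has at most the
  cardinality of the continuum. For any \<open>'a\<close> it is implied by the full universal property. That
  the \<open>u i j\<close> generate \<open>A\<close> is contained in the uniqueness part.
\<close>

definition universal_cstar ::
    "nat \<Rightarrow> ('a cstar \<Rightarrow> (nat \<Rightarrow> nat \<Rightarrow> 'a) \<Rightarrow> bool) \<Rightarrow> 'a cstar \<Rightarrow> (nat \<Rightarrow> nat \<Rightarrow> 'a) \<Rightarrow> bool" where
  "universal_cstar N R A u \<longleftrightarrow>
     unital_cstar_algebra A \<and> matrix_in N A u \<and> R A u \<and>
     (\<forall>B w. unital_cstar_algebra B \<and> matrix_in N B w \<and> R B w \<longrightarrow>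
        (\<exists>\<phi>. star_hom A B \<phi> \<and> (\<forall>i\<in>{1..N}. \<forall>j\<in>{1..N}. \<phi> (u i j) = w i j) \<and>
           (\<forall>\<psi>. star_hom A B \<psi> \<and> (\<forall>i\<in>{1..N}. \<forall>j\<in>{1..N}. \<psi> (u i j) = w i j) \<longrightarrow>
              (\<forall>x\<in>carrier A. \<psi> x = \<phi> x))))"


section \<open>The quantum group attached to a matrix \<open>M\<close>\<close>

definition magic_unitary :: "nat \<Rightarrow> 'a cstar \<Rightarrow> (nat \<Rightarrow> nat \<Rightarrow> 'a) \<Rightarrow> bool" where
  "magic_unitary N A p \<longleftrightarrow>
     (\<forall>i\<in>{1..N}. \<forall>j\<in>{1..N}. projection A (p i j)) \<and>
     (\<forall>i\<in>{1..N}. (\<Oplus>\<^bsub>A\<^esub>j\<in>{1..N}. p i j) = \<one>\<^bsub>A\<^esub>) \<and>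
     (\<forall>j\<in>{1..N}. (\<Oplus>\<^bsub>A\<^esub>i\<in>{1..N}. p i j) = \<one>\<^bsub>A\<^esub>)"

text \<open>
  For an irreducible nonnegative matrix, the strictly positive eigenvectors are the
  Perron--Frobenius eigenvector and its positive multiples. The condition
  \<open>preserves_vector\<close> does not depend on the scaling.
\<close>

definition perron_frobenius_vector :: "nat \<Rightarrow> (nat \<Rightarrow> nat \<Rightarrow> real) \<Rightarrow> (nat \<Rightarrow> real) \<Rightarrow> bool" where
  "perron_frobenius_vector N M \<omega> \<longleftrightarrow>
     (\<forall>i\<in>{1..N}. \<omega> i > 0) \<and> (\<exists>r. \<forall>i\<in>{1..N}. (\<Sum>j\<in>{1..N}. M i j * \<omega> j) = r * \<omega> i)"

definition preserves_vector ::
    "nat \<Rightarrow> 'a cstar \<Rightarrow> (nat \<Rightarrow> nat \<Rightarrow> 'a) \<Rightarrow> (nat \<Rightarrow> real) \<Rightarrow> bool" where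
  "preserves_vector N A p \<omega> \<longleftrightarrow>
     (\<forall>i\<in>{1..N}. (\<Oplus>\<^bsub>A\<^esub>j\<in>{1..N}. complex_of_real (\<omega> j) \<odot>\<^bsub>A\<^esub> p i j) =
        complex_of_real (\<omega> i) \<odot>\<^bsub>A\<^esub> \<one>\<^bsub>A\<^esub>)"

definition range_proj :: "'a cstar \<Rightarrow> (nat \<Rightarrow> nat \<Rightarrow> 'a) \<Rightarrow> nat \<Rightarrow> nat \<Rightarrow> 'a" where
  "range_proj A u i j = u i j \<otimes>\<^bsub>A\<^esub> star A (u i j)"

definition source_proj :: "'a cstar \<Rightarrow> (nat \<Rightarrow> nat \<Rightarrow> 'a) \<Rightarrow> nat \<Rightarrow> nat \<Rightarrow> 'a" where
  "source_proj A u i j = star A (u i j) \<otimes>\<^bsub>A\<^esub> u i j"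

definition G_relations ::
    "nat \<Rightarrow> (nat \<Rightarrow> nat \<Rightarrow> real) \<Rightarrow> enat \<Rightarrow> 'a cstar \<Rightarrow> (nat \<Rightarrow> nat \<Rightarrow> 'a) \<Rightarrow> bool" where
  "G_relations N M L A u \<longleftrightarrow>
     (let p = range_proj A u; q = source_proj A u in
       (\<forall>i\<in>{1..N}. \<forall>j\<in>{1..N}. partial_isometry A (u i j)) \<and>
       \<comment> \<open>(I)\<close>
       magic_unitary N A p \<and> magic_unitary N A q \<and>
       (\<forall>\<omega>. perron_frobenius_vector N M \<omega> \<longrightarrow>
          preserves_vector N A p \<omega> \<and> preserves_vector N A q \<omega>) \<and>
       \<comment> \<open>(II)\<close>
       (\<forall>i\<in>{1..N}. \<forall>j\<in>{1..N}.
          (\<Oplus>\<^bsub>A\<^esub>k\<in>{1..N}. complex_of_real (M i k) \<odot>\<^bsub>A\<^esub> p k j) =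
          (\<Oplus>\<^bsub>A\<^esub>k\<in>{1..N}. complex_of_real (M k j) \<odot>\<^bsub>A\<^esub> q i k)) \<and>
       \<comment> \<open>(III)\<close>
       (\<forall>I J. length I = length J \<and> 1 \<le> length I \<and> enat (length I) \<le> L \<and>
          set I \<subseteq> {1..N} \<and> set J \<subseteq> {1..N} \<longrightarrow>
          partial_isometry A (prod_word A (map2 u I J))))"

definition all_ones :: "nat \<Rightarrow> nat \<Rightarrow> real" where
  "all_ones i j = 1"


section \<open>The hyperoctahedral unitary easy quantum groups\<close>

definition conj_matrix :: "'a cstar \<Rightarrow> (nat \<Rightarrow> nat \<Rightarrow> 'a) \<Rightarrow> nat \<Rightarrow> nat \<Rightarrow> 'a" where
  "conj_matrix A v i j = star A (v i j)"

definition unitary_matrix :: "nat \<Rightarrow> 'a cstar \<Rightarrow> (nat \<Rightarrow> nat \<Rightarrow> 'a) \<Rightarrow> bool" where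
  "unitary_matrix N A v \<longleftrightarrow> (\<forall>i\<in>{1..N}. \<forall>j\<in>{1..N}.
     (\<Oplus>\<^bsub>A\<^esub>k\<in>{1..N}. v i k \<otimes>\<^bsub>A\<^esub> star A (v j k)) = (if i = j then \<one>\<^bsub>A\<^esub> else \<zero>\<^bsub>A\<^esub>) \<and>
     (\<Oplus>\<^bsub>A\<^esub>k\<in>{1..N}. star A (v k i) \<otimes>\<^bsub>A\<^esub> v k j) = (if i = j then \<one>\<^bsub>A\<^esub> else \<zero>\<^bsub>A\<^esub>))"

text \<open>
  With \<open>x = v\<close>, \<open>y = conj_matrix A v\<close> this is the relation attached to the white word of length
  \<open>k\<close>; with the roles of \<open>x\<close> and \<open>y\<close> exchanged, the one attached to the black word. The letters
  of the second factor appear in reverse order.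
\<close>

definition word_relation ::
    "nat \<Rightarrow> 'a cstar \<Rightarrow> nat \<Rightarrow> (nat \<Rightarrow> nat \<Rightarrow> 'a) \<Rightarrow> (nat \<Rightarrow> nat \<Rightarrow> 'a) \<Rightarrow> bool" where
  "word_relation N A k x y \<longleftrightarrow>
     (\<forall>I J S T. length I = k \<and> length J = k \<and> length S = k \<and> length T = k \<and>
        set I \<subseteq> {1..N} \<and> set J \<subseteq> {1..N} \<and> set S \<subseteq> {1..N} \<and> set T \<subseteq> {1..N} \<longrightarrow>
        (let z = prod_word A (map2 x I J @ rev (map2 y S T)) in
          (if J = T then z else \<zero>\<^bsub>A\<^esub>) = (if I = S then z else \<zero>\<^bsub>A\<^esub>)))"

definition H_relations ::
    "nat \<Rightarrow> enat \<Rightarrow> 'a cstar \<Rightarrow> (nat \<Rightarrow> nat \<Rightarrow> 'a) \<Rightarrow> bool" where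
  "H_relations N L A v \<longleftrightarrow>
     unitary_matrix N A v \<and> unitary_matrix N A (conj_matrix A v) \<and>
     (\<forall>k\<ge>1. enat k \<le> L \<longrightarrow>
        word_relation N A k v (conj_matrix A v) \<and> word_relation N A k (conj_matrix A v) v)"


section \<open>Tensor products and coproducts\<close>

text \<open>
  \<open>T\<close> is the completion of the algebraic tensor product of \<open>A\<close> and \<open>B\<close> in some C*-norm, where
  \<open>\<iota> a \<otimes> \<kappa> b\<close> is the elementary tensor of \<open>a\<close> and \<open>b\<close>. The clause with the
  scalars \<open>c\<close> says that the algebraic tensor product embeds into \<open>T\<close>: a finite sum of
  elementary tensors with linearly independent left legs vanishes only if all right legs
  vanish. The last clause says that it is dense.
\<close>

definition cstar_tensor ::
    "'a cstar \<Rightarrow> 'a cstar \<Rightarrow> 'a cstar \<Rightarrow> ('a \<Rightarrow> 'a) \<Rightarrow> ('a \<Rightarrow> 'a) \<Rightarrow> bool" where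
  "cstar_tensor A B T \<iota> \<kappa> \<longleftrightarrow>
     unital_cstar_algebra T \<and> star_hom A T \<iota> \<and> star_hom B T \<kappa> \<and>
     (\<forall>a\<in>carrier A. \<forall>b\<in>carrier B. \<iota> a \<otimes>\<^bsub>T\<^esub> \<kappa> b = \<kappa> b \<otimes>\<^bsub>T\<^esub> \<iota> a) \<and>
     (\<forall>(n::nat) a b. (\<forall>k<n. a k \<in> carrier A \<and> b k \<in> carrier B) \<and>
        (\<forall>c. (\<Oplus>\<^bsub>A\<^esub>k\<in>{..<n}. c k \<odot>\<^bsub>A\<^esub> a k) = \<zero>\<^bsub>A\<^esub> \<longrightarrow> (\<forall>k<n. c k = 0)) \<and>
        (\<Oplus>\<^bsub>T\<^esub>k\<in>{..<n}. \<iota> (a k) \<otimes>\<^bsub>T\<^esub> \<kappa> (b k)) = \<zero>\<^bsub>T\<^esub> \<longrightarrow> (\<forall>k<n. b k = \<zero>\<^bsub>B\<^esub>)) \<and>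
     (\<forall>x\<in>carrier T. \<forall>e>0. \<exists>(n::nat) a b. (\<forall>k<n. a k \<in> carrier A \<and> b k \<in> carrier B) \<and>
        nrm T (x \<ominus>\<^bsub>T\<^esub> (\<Oplus>\<^bsub>T\<^esub>k\<in>{..<n}. \<iota> (a k) \<otimes>\<^bsub>T\<^esub> \<kappa> (b k))) < e)"

text \<open>
  The minimal (spatial) tensor product is the completion in the least C*-norm (Takesaki's theorem).
\<close>

definition minimal_tensor ::
    "'a cstar \<Rightarrow> 'a cstar \<Rightarrow> 'a cstar \<Rightarrow> ('a \<Rightarrow> 'a) \<Rightarrow> ('a \<Rightarrow> 'a) \<Rightarrow> bool" where
  "minimal_tensor A B T \<iota> \<kappa> \<longleftrightarrow> cstar_tensor A B T \<iota> \<kappa> \<and>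
     (\<forall>T' \<iota>' \<kappa>'. cstar_tensor A B T' \<iota>' \<kappa>' \<longrightarrow>
        (\<exists>\<pi>. star_hom T' T \<pi> \<and> (\<forall>a\<in>carrier A. \<pi> (\<iota>' a) = \<iota> a) \<and>
             (\<forall>b\<in>carrier B. \<pi> (\<kappa>' b) = \<kappa> b)))"

text \<open>
  \<open>tensor_map\<close> says \<open>\<Phi> = \<phi> \<otimes> \<phi>\<close>, as a map from \<open>T\<close>, a tensor product of \<open>A\<close> with itself, to \<open>S\<close>.
\<close>

definition tensor_map ::
    "'a cstar \<Rightarrow> 'a cstar \<Rightarrow> ('a \<Rightarrow> 'a) \<Rightarrow> ('a \<Rightarrow> 'a) \<Rightarrow> 'a cstar \<Rightarrow> ('a \<Rightarrow> 'a) \<Rightarrow> ('a \<Rightarrow> 'a) \<Rightarrow>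
     ('a \<Rightarrow> 'a) \<Rightarrow> ('a \<Rightarrow> 'a) \<Rightarrow> bool" where
  "tensor_map A T \<iota> \<kappa> S \<iota>' \<kappa>' \<phi> \<Phi> \<longleftrightarrow> star_hom T S \<Phi> \<and>
     (\<forall>x\<in>carrier A. \<forall>y\<in>carrier A. \<Phi> (\<iota> x \<otimes>\<^bsub>T\<^esub> \<kappa> y) = \<iota>' (\<phi> x) \<otimes>\<^bsub>S\<^esub> \<kappa>' (\<phi> y))"

definition coproduct ::
    "nat \<Rightarrow> 'a cstar \<Rightarrow> (nat \<Rightarrow> nat \<Rightarrow> 'a) \<Rightarrow> 'a cstar \<Rightarrow> ('a \<Rightarrow> 'a) \<Rightarrow> ('a \<Rightarrow> 'a) \<Rightarrow> ('a \<Rightarrow> 'a) \<Rightarrow> bool" where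
  "coproduct N A u T \<iota> \<kappa> \<Delta> \<longleftrightarrow> star_hom A T \<Delta> \<and>
     (\<forall>i\<in>{1..N}. \<forall>j\<in>{1..N}.
        \<Delta> (u i j) = (\<Oplus>\<^bsub>T\<^esub>k\<in>{1..N}. \<iota> (u i k) \<otimes>\<^bsub>T\<^esub> \<kappa> (u k j)))"

end

theory Submission
  imports Defs "HOL-Computational_Algebra.Polynomial"
begin

text \<open>
  The two sets of relations are equivalent in every unital C*-algebra, so the universal algebras
  are isomorphic over their generators; the statement on coproducts follows from the uniqueness
  part of the universal property and the functoriality of the minimal tensor product.

  From \<open>G\<close> to \<open>H\<close>: projections summing to \<open>1\<close> are pairwise orthogonal, so the entries of a row or a
  column have orthogonal ranges and supports. If \<open>x\<close>, \<open>y\<close> and \<open>x y\<close> are partial isometries, then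
  \<open>x\<^sup>* x\<close> and \<open>y y\<^sup>*\<close> commute, which propagates the orthogonality from letters to words. From \<open>H\<close> to
  \<open>G\<close>: the relations for words of length \<open>k\<close> show that \<open>v\<^sub>i\<^sub>j\<^sup>* v\<^sub>i\<^sub>j\<close> commutes with the range projection
  of each word of length \<open>k - 1\<close>, so that words are partial isometries by induction.

  The orthogonality of the projections is the only analytic ingredient. It is usually deduced from
  the theory of positive elements; here it is reduced to the fact that \<open>\<parallel>1 + h\<parallel> \<le> 1\<close> and
  \<open>\<parallel>1 - h\<parallel> \<le> 1\<close> force a self-adjoint \<open>h\<close> to vanish.
\<close>

section \<open>Self-adjoint perturbations of the unit\<close>

lemma map_poly_cnj_add: "map_poly cnj (f + g) = map_poly cnj f + map_poly cnj g"
  by (rule poly_eqI) (simp add: coeff_map_poly)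

lemma map_poly_cnj_smult: "map_poly cnj (Polynomial.smult c f) = Polynomial.smult (cnj c) (map_poly cnj f)"
  by (rule poly_eqI) (simp add: coeff_map_poly)

lemma map_poly_cnj_mult: "map_poly cnj (f * g) = map_poly cnj f * map_poly cnj g"
  by (rule poly_eqI) (simp add: coeff_map_poly coeff_mult)

lemma poly_ext: "(\<And>x. poly f x = poly g x) \<Longrightarrow> f = g"
  for f g :: "'a::{comm_ring_1, ring_no_zero_divisors, ring_char_0} poly"
  by (simp add: poly_eq_poly_eq_iff[symmetric] fun_eq_iff del: poly_eq_poly_eq_iff)

text \<open>
  The set \<open>K\<close> below is stable under \<open>f \<mapsto> 3/2 f + 1/2 f\<^sup>3\<close>, which enlarges the norm of \<open>f\<close> by a factor
  of at least \<open>7/6\<close>, although \<open>K\<close> is bounded. The stability comes from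
  \<open>(1 \<plusminus> f)\<^sup>3 + (1 - 3 f\<^sup>2) = 2 (1 \<plusminus> (3/2 f + 1/2 f\<^sup>3))\<close>, once \<open>1 - 3 f\<^sup>2\<close> is known to be a contraction.
\<close>

lemma seminorm_poly_X_eq_0:
  fixes n :: "complex poly \<Rightarrow> real"
  assumes add: "\<And>f g. n (f + g) \<le> n f + n g"
    and mult: "\<And>f g. n (f * g) \<le> n f * n g"
    and scale: "\<And>c f. n (Polynomial.smult c f) = cmod c * n f"
    and nonneg: "\<And>f. 0 \<le> n f"
    and cstar: "\<And>f. n (map_poly cnj f * f) = (n f)\<^sup>2"
    and plus: "n [:1, 1:] \<le> 1" and minus: "n [:1, -1:] \<le> 1"
  shows "n [:0, 1:] = 0"
proof -
  \<comment> \<open>Conjugation of coefficients plays the role of the star, so the first clause of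
    \<open>K\<close> says that \<open>f\<close> is self-adjoint.\<close>
  define K where "K f \<longleftrightarrow> map_poly cnj f = f \<and> n (1 + f) \<le> 1 \<and> n (1 - f) \<le> 1" for f
  \<comment> \<open>The triangle inequality for the mean \<open>h\<close> of two contractions, with
    the factor 2 kept on the side of \<open>h\<close> to avoid denominators.\<close>
  have half: "n h \<le> 1" if "n f \<le> 1" "n g \<le> 1" "f + g = Polynomial.smult 2 h" for f g h
  proof -
    have "2 * n h = n (f + g)"
      by (simp add: that(3) scale)
    then show ?thesis
      using add[of f g] that by linarith
  qed
  have mult1: "n (f * g) \<le> 1" if "n f \<le> 1" "n g \<le> 1" for f g
    using mult[of f g] mult_mono[OF that] nonneg by (smt (verit))
  have cube: "n (f ^ 3) \<le> 1" if "n f \<le> 1" for f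
    using that by (auto simp: power3_eq_cube intro!: mult1)
  have cnj1: "map_poly cnj 1 = 1"
    by (rule poly_eqI) (simp add: coeff_map_poly)
  \<comment> \<open>\<open>1 + f\<^sup>2\<close> is the mean of \<open>(1 + f)\<^sup>2\<close> and
    \<open>(1 - f)\<^sup>2\<close>. It is also \<open>c\<^sup>* c\<close> for
    \<open>c = 1 \<plusminus> \<i> f\<close>, so these two elements are contractions, and
    \<open>1 - 3 f\<^sup>2\<close> is the mean of their cubes.\<close>
  have sq: "n (1 - Polynomial.smult 3 (f ^ 2)) \<le> 1" if "K f" for f
  proof -
    have *: "n (1 + f\<^sup>2) \<le> 1"
    proof (rule half)
      show "n ((1 + f) * (1 + f)) \<le> 1" "n ((1 - f) * (1 - f)) \<le> 1"
        using that by (auto simp: K_def intro!: mult1)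
      show "(1 + f) * (1 + f) + (1 - f) * (1 - f) = Polynomial.smult 2 (1 + f\<^sup>2)"
        by (rule poly_ext) (simp add: algebra_simps power2_eq_square)
    qed
    have "n (1 + Polynomial.smult c f) \<le> 1" if c: "c = \<i> \<or> c = - \<i>" for c
    proof -
      have "map_poly cnj (1 + Polynomial.smult c f) * (1 + Polynomial.smult c f) = 1 + f\<^sup>2"
        using \<open>K f\<close> c by (auto simp: K_def map_poly_cnj_add map_poly_cnj_smult cnj1
            algebra_simps power2_eq_square)
      then have "(n (1 + Polynomial.smult c f))\<^sup>2 \<le> 1"
        using cstar[of "1 + Polynomial.smult c f"] * by simp
      then show ?thesis
        using power2_le_imp_le[of _ 1] by auto
    qed
    then have "n ((1 + Polynomial.smult \<i> f) ^ 3) \<le> 1" "n ((1 + Polynomial.smult (- \<i>) f) ^ 3) \<le> 1"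
      by (auto intro: cube simp del: smult_minus_left)
    then show ?thesis
    proof (rule half)
      show "(1 + Polynomial.smult \<i> f) ^ 3 + (1 + Polynomial.smult (- \<i>) f) ^ 3 = Polynomial.smult 2 (1 - Polynomial.smult 3 (f\<^sup>2))"
      proof (rule poly_ext)
        have "(1 + c * y) ^ 3 + (1 - c * y) ^ 3 = 2 * (1 + 3 * (c * c) * y\<^sup>2)" for c y :: complex
          by (simp add: power3_eq_cube power2_eq_square algebra_simps)
        from this[of \<i>]
        show "poly ((1 + Polynomial.smult \<i> f) ^ 3 + (1 + Polynomial.smult (- \<i>) f) ^ 3) x =
            poly (Polynomial.smult 2 (1 - Polynomial.smult 3 (f\<^sup>2))) x" for x
          by simp
      qed
    qed
  qed
  define F where "F f = Polynomial.smult (3/2) f + Polynomial.smult (1/2) (f ^ 3)" for f :: "complex poly"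
  have K_F: "K (F f)" if "K f" for f
  proof -
    have *: "n (1 + F f) \<le> 1" if "K f" for f
    proof (rule half)
      show "n ((1 + f) ^ 3) \<le> 1" "n (1 - Polynomial.smult 3 (f ^ 2)) \<le> 1"
        using that sq by (auto simp: K_def intro: cube)
      show "(1 + f) ^ 3 + (1 - Polynomial.smult 3 (f\<^sup>2)) = Polynomial.smult 2 (1 + F f)"
        by (rule poly_ext) (simp add: F_def power3_eq_cube power2_eq_square field_simps)
    qed
    \<comment> \<open>\<open>F\<close> is odd and \<open>K\<close> is invariant under
      \<open>f \<mapsto> - f\<close>, so the bound for \<open>1 + F f\<close> also covers
      \<open>1 - F f\<close>.\<close>
    have F_minus: "F (- f) = - F f"
      by (simp add: F_def power3_eq_cube)
    have "map_poly cnj (- f) = - map_poly cnj f"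
      using map_poly_cnj_smult[of "-1" f] by simp
    then have "K (- f)"
      using that by (simp add: K_def)
    then have "n (1 - F f) \<le> 1"
      using *[of "- f"] by (simp add: F_minus)
    moreover have "map_poly cnj (F f) = F (map_poly cnj f)"
      by (simp add: F_def map_poly_cnj_add map_poly_cnj_smult map_poly_cnj_mult power3_eq_cube)
    ultimately show ?thesis
      using that *[of f] by (simp add: K_def)
  qed
  \<comment> \<open>\<open>3 f\<^sup>2\<close> is the difference of the contractions
    \<open>1\<close> and \<open>1 - 3 f\<^sup>2\<close>, and \<open>n (f\<^sup>2)\<close> is the
    square of \<open>n f\<close> because \<open>f\<close> is self-adjoint.\<close>
  have bd: "(n f)\<^sup>2 \<le> 2 / 3" if "K f" for f
  proof -
    have "n 1 \<le> 1"
    proof (rule half)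
      show "n (1 + f) \<le> 1" "n (1 - f) \<le> 1"
        using that by (simp_all add: K_def)
      show "1 + f + (1 - f) = Polynomial.smult 2 1"
        by (rule poly_ext) simp
    qed
    have "3 * n (f\<^sup>2) = n (1 + Polynomial.smult (-1) (1 - Polynomial.smult 3 (f\<^sup>2)))"
      by (simp add: scale)
    also have "\<dots> \<le> 2"
      using add[of 1 "Polynomial.smult (-1) (1 - Polynomial.smult 3 (f\<^sup>2))"] sq[OF that] \<open>n 1 \<le> 1\<close>
        scale[of "-1" "1 - Polynomial.smult 3 (f\<^sup>2)"] by simp
    finally show ?thesis
      using cstar[of f] that by (simp add: K_def power2_eq_square)
  qed
  \<comment> \<open>From \<open>3/2 f = F f - 1/2 f\<^sup>3\<close> and
    \<open>n (f\<^sup>3) \<le> 2/3 n f\<close> the growth factor is 3/2 - 1/3 = 7/6. The bound with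
    exponent \<open>k\<close> for \<open>F f\<close> therefore gives the bound with exponent
    \<open>k + 1\<close> for \<open>f\<close>.\<close>
  have decay: "n f \<le> (6 / 7) ^ k" if "K f" for f k
    using that
  proof (induction k arbitrary: f)
    case 0
    then show ?case
      using bd[of f] power2_le_imp_le[of "n f" 1] by simp
  next
    case (Suc k)
    have "3 / 2 * n f = n (F f + Polynomial.smult (- (1 / 2)) (f ^ 3))"
      by (simp add: F_def scale)
    also have "\<dots> \<le> n (F f) + 1 / 2 * n (f ^ 3)"
      using add[of "F f" "Polynomial.smult (- (1 / 2)) (f ^ 3)"] scale[of "- (1 / 2)" "f ^ 3"]
      by simp
    also have "n (f ^ 3) \<le> (n f)\<^sup>2 * n f"
      using mult[of "f * f" f] mult[of f f] mult_right_mono[OF mult[of f f] nonneg[of f]]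
      by (simp add: power3_eq_cube power2_eq_square)
    also have "(n f)\<^sup>2 * n f \<le> 2 / 3 * n f"
      using bd[OF Suc.prems] nonneg by (rule mult_right_mono)
    finally show ?case
      using Suc.IH[OF K_F[OF Suc.prems]] by simp
  qed
  have "K [:0, 1:]"
    using plus minus by (simp add: K_def one_pCons map_poly_pCons)
  then have "n [:0, 1:] \<le> 0"
    using decay LIMSEQ_le_const[OF LIMSEQ_power_zero[of "6 / 7 :: real"], of "n [:0, 1:]"] by auto
  then show ?thesis
    using nonneg[of "[:0, 1:]"] by linarith
qed

section \<open>Elementary algebra in a unital C*-algebra\<close>

context unital_cstar_algebra
begin

lemma cstar_closed [simp, intro]:
  "x \<in> carrier A \<Longrightarrow> c \<odot> x \<in> carrier A" "x \<in> carrier A \<Longrightarrow> star A x \<in> carrier A"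
  by (fact smult_closed star_closed)+

declare star_star [simp]

lemma smult_zero_left [simp]: "x \<in> carrier A \<Longrightarrow> 0 \<odot> x = \<zero>"
  using smult_l_distr[of x 0 0] add.r_cancel_one'[of "0 \<odot> x" "0 \<odot> x"] by simp

lemma smult_zero_right [simp]: "c \<odot> \<zero> = \<zero>"
  using smult_r_distr[of \<zero> \<zero> c] add.r_cancel_one'[of "c \<odot> \<zero>" "c \<odot> \<zero>"] by simp

lemma smult_minus_one: "x \<in> carrier A \<Longrightarrow> (-1) \<odot> x = \<ominus> x"
  using smult_l_distr[of x "-1" 1] smult_one[of x] by (intro minus_equality[symmetric]) auto

lemma star_zero [simp]: "star A \<zero> = \<zero>"
  using star_smult[of \<zero> 0] by simp

lemma star_one [simp]: "star A \<one> = \<one>"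
  using star_mult[of "star A \<one>" "\<one>"] by simp

lemma star_minus: "x \<in> carrier A \<Longrightarrow> y \<in> carrier A \<Longrightarrow> star A (x \<ominus> y) = star A x \<ominus> star A y"
  using star_smult[of y "-1"] by (simp add: minus_eq star_add smult_minus_one)

lemma nrm_zero [simp]: "nrm A \<zero> = 0"
  by (simp add: nrm_eq_zero)

text \<open>By the C*-identity. It serves to pass from the vanishing of a compression
  \<open>e p e\<close> of a projection \<open>p\<close> to that of \<open>p e\<close>.\<close>

lemma star_mult_self_eq_zero: "x \<in> carrier A \<Longrightarrow> star A x \<otimes> x = \<zero> \<Longrightarrow> x = \<zero>"
  using cstar_identity[of x] by (simp add: nrm_eq_zero)

lemma projectionD:
  assumes "projection A x"
  shows "x \<in> carrier A" "star A x = x" "x \<otimes> x = x"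
  using assms by (auto simp: projection_def)

text \<open>The C*-identity turns into
  \<open>\<parallel>p\<parallel> = \<parallel>p\<parallel>\<^sup>2\<close>.\<close>

lemma nrm_projection: "projection A p \<Longrightarrow> nrm A p \<le> 1"
  using cstar_identity[of p] nrm_nonneg[of p] by (auto simp: projection_def power2_eq_square)

lemma projection_one_minus: "projection A p \<Longrightarrow> projection A (\<one> \<ominus> p)"
  unfolding projection_def
  by (auto simp: star_minus) (simp add: minus_eq l_distr r_distr l_minus r_minus a_ac r_neg)

end

text \<open>
  \<open>poly_at A e h f\<close> evaluates \<open>f\<close> at \<open>h\<close> in a corner of \<open>A\<close> with unit \<open>e\<close>, so that the constant
  polynomial \<open>1\<close> is sent to \<open>e\<close>.
\<close>

definition poly_at :: "'a cstar \<Rightarrow> 'a \<Rightarrow> 'a \<Rightarrow> complex poly \<Rightarrow> 'a" where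
  "poly_at A e h f = fold_coeffs (\<lambda>a y. a \<odot>\<^bsub>A\<^esub> e \<oplus>\<^bsub>A\<^esub> h \<otimes>\<^bsub>A\<^esub> y) f \<zero>\<^bsub>A\<^esub>"

context unital_cstar_algebra
begin

context
  fixes e h
  assumes e [simp]: "e \<in> carrier A" and h [simp]: "h \<in> carrier A"
    and ee: "e \<otimes> e = e" and eh: "e \<otimes> h = h" and he: "h \<otimes> e = h"
begin

private abbreviation "ev \<equiv> poly_at A e h"

lemma poly_at_0 [simp]: "ev 0 = \<zero>"
  by (simp add: poly_at_def)

lemma poly_at_pCons: "ev (pCons a f) = a \<odot> e \<oplus> h \<otimes> ev f"
  by (cases "a = 0 \<and> f = 0") (auto simp: poly_at_def)

lemma poly_at_closed [simp]: "ev f \<in> carrier A"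
  by (induction f) (auto simp: poly_at_pCons)

lemma poly_at_add: "ev (f + g) = ev f \<oplus> ev g"
proof (induction f arbitrary: g)
  case (pCons a f)
  obtain b g' where "g = pCons b g'"
    by (cases g)
  then show ?case
    using pCons by (simp add: poly_at_pCons smult_l_distr r_distr a_ac)
qed simp

lemma poly_at_smult: "ev (Polynomial.smult c f) = c \<odot> ev f"
  by (induction f) (auto simp: poly_at_pCons smult_r_distr smult_assoc smult_mult_right)

lemma unit_mult_poly_at: "e \<otimes> ev f = ev f"
  by (induction f)
    (auto simp: poly_at_pCons r_distr smult_mult_right ee eh simp flip: m_assoc)

text \<open>Adjoints move the factor \<open>h\<close> to the other side, so this is what makes
  evaluation compatible with conjugation of the coefficients.\<close>

lemma poly_at_commute: "ev f \<otimes> h = h \<otimes> ev f"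
proof (induction f)
  case (pCons a f)
  have "ev (pCons a f) \<otimes> h = a \<odot> (e \<otimes> h) \<oplus> h \<otimes> (ev f \<otimes> h)"
    by (simp add: poly_at_pCons l_distr smult_mult_left m_assoc)
  also have "\<dots> = h \<otimes> ev (pCons a f)"
    using pCons by (simp add: poly_at_pCons r_distr smult_mult_right eh he)
  finally show ?case .
qed simp

lemma poly_at_mult: "ev (f * g) = ev f \<otimes> ev g"
  by (induction f)
    (auto simp: poly_at_pCons poly_at_add poly_at_smult l_distr smult_mult_left unit_mult_poly_at m_assoc)

lemma poly_at_map_cnj:
  assumes "star A e = e" "star A h = h"
  shows "ev (map_poly cnj f) = star A (ev f)"
proof (induction f)
  case (pCons a f)
  have "star A (ev (pCons a f)) = cnj a \<odot> e \<oplus> star A (ev f) \<otimes> h"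
    by (simp add: poly_at_pCons star_add star_smult star_mult assms)
  then show ?case
    using pCons poly_at_commute[of "map_poly cnj f"] by (simp add: map_poly_pCons poly_at_pCons)
qed simp

end

text \<open>That is, \<open>e\<close> behaves like an extreme point of the unit ball of the corner \<open>e A e\<close>.\<close>

lemma selfadjoint_eq_zero_if_nrm_plus_minus_le:
  assumes e: "projection A e" and h: "h \<in> carrier A" "star A h = h" and eh: "e \<otimes> h = h"
    and plus: "nrm A (e \<oplus> h) \<le> 1" and minus: "nrm A (e \<ominus> h) \<le> 1"
  shows "h = \<zero>"
proof -
  note eD = projectionD[OF e]
  have he: "h \<otimes> e = h"
    using star_mult[OF eD(1) h(1)] eh eD h by simp
  note c [simp] = poly_at_closed[OF eD(1) h(1) eD(3) eh he]
    and ev = poly_at_0[OF eD(1) h(1) eD(3) eh he] poly_at_pCons[OF eD(1) h(1) eD(3) eh he]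
  \<comment> \<open>The seminorm of a polynomial is the norm of its value at \<open>h\<close> in the
    corner with unit \<open>e\<close>. The polynomials \<open>1 + X\<close>, \<open>1 - X\<close>
    and \<open>X\<close> have the values \<open>e + h\<close>, \<open>e - h\<close> and
    \<open>h\<close>.\<close>
  have "nrm A (poly_at A e h [:0, 1:]) = 0"
  proof (rule seminorm_poly_X_eq_0)
    show "nrm A (poly_at A e h [:1, 1:]) \<le> 1"
      using plus eD h he by (simp add: ev smult_one)
    show "nrm A (poly_at A e h [:1, - 1:]) \<le> 1"
      using minus eD h he by (simp add: ev smult_one smult_minus_one minus_eq r_minus)
    show "nrm A (poly_at A e h (map_poly cnj f * f)) = (nrm A (poly_at A e h f))\<^sup>2" for f
      using eD h eh he
      by (simp add: poly_at_mult poly_at_map_cnj cstar_identity)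
  qed (use eD h eh he in \<open>simp_all add: poly_at_add poly_at_mult poly_at_smult nrm_triangle
    nrm_mult nrm_smult nrm_nonneg\<close>)
  then show ?thesis
    using eD h he by (simp add: ev smult_one nrm_eq_zero)
qed

section \<open>Orthogonality of projections that sum to the unit\<close>

lemma nrm_finsum_le:
  assumes "finite S" "\<And>j. j \<in> S \<Longrightarrow> f j \<in> carrier A" "\<And>j. j \<in> S \<Longrightarrow> nrm A (f j) \<le> 1"
  shows "nrm A (\<Oplus>j\<in>S. f j) \<le> card S"
  using assms
proof (induction S rule: finite_induct)
  case (insert j S)
  then have fS: "f \<in> S \<rightarrow> carrier A"
    by auto
  have "nrm A (f j \<oplus> (\<Oplus>j\<in>S. f j)) \<le> nrm A (f j) + nrm A (\<Oplus>j\<in>S. f j)"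
    using insert fS by (intro nrm_triangle finsum_closed) auto
  also have "\<dots> \<le> 1 + card S"
    using insert.IH insert.prems by fastforce
  finally show ?case
    using insert fS by simp
qed simp

lemma minus_add_minus:
  "\<lbrakk>x \<in> carrier A; y \<in> carrier A; z \<in> carrier A; w \<in> carrier A\<rbrakk> \<Longrightarrow>
    (x \<ominus> y) \<oplus> (z \<ominus> w) = (x \<oplus> z) \<ominus> (y \<oplus> w)"
  by (simp add: minus_eq minus_add a_ac)

text \<open>The element is the sum of the contractions \<open>e - f j\<close> over
  \<open>j \<noteq> k\<close>, because these \<open>f j\<close> add up to \<open>- f k\<close>;
  there are \<open>card S - 1\<close> of them.\<close>

lemma nrm_le_card_if_sum_eq_zero: 
  assumes "finite S" "\<And>j. j \<in> S \<Longrightarrow> f j \<in> carrier A" "e \<in> carrier A"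
    and "\<And>j. j \<in> S \<Longrightarrow> nrm A (e \<ominus> f j) \<le> 1" "k \<in> S" "(\<Oplus>j\<in>S. f j) = \<zero>"
  shows "nrm A (complex_of_nat (card S - 1) \<odot> e \<oplus> f k) \<le> card S - 1"
proof -
  have *: "(\<Oplus>j\<in>F. e \<ominus> f j) = complex_of_nat (card F) \<odot> e \<ominus> (\<Oplus>j\<in>F. f j)"
    if "finite F" "F \<subseteq> S" for F
    using that
  proof (induction F rule: finite_induct)
    case empty
    then show ?case using assms(3) by (simp add: minus_eq)
  next
    case (insert j F)
    have [simp]: "f \<in> F \<rightarrow> carrier A" "(\<lambda>j. e \<ominus> f j) \<in> F \<rightarrow> carrier A" "f j \<in> carrier A"
      using assms insert by auto
    have IH: "(\<Oplus>i\<in>F. e \<ominus> f i) = complex_of_nat (card F) \<odot> e \<ominus> (\<Oplus>i\<in>F. f i)"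
      using insert by simp
    have "(\<Oplus>i\<in>insert j F. e \<ominus> f i) = (e \<ominus> f j) \<oplus> (complex_of_nat (card F) \<odot> e \<ominus> (\<Oplus>i\<in>F. f i))"
      using insert(1,2) assms(3) by (simp add: IH)
    also have "\<dots> = (e \<oplus> complex_of_nat (card F) \<odot> e) \<ominus> (f j \<oplus> (\<Oplus>i\<in>F. f i))"
      using assms(3) by (intro minus_add_minus) auto
    finally show ?case
      using insert(1,2) assms(3) by (simp add: smult_l_distr smult_one)
  qed
  define F where "F = S - {k}"
  have F: "finite F" "F \<subseteq> S" "k \<notin> F" "S = insert k F" "card F = card S - 1"
    using assms by (auto simp: F_def)
  have [simp]: "f \<in> F \<rightarrow> carrier A" "f k \<in> carrier A"
    using assms F by auto
  have "f k \<oplus> (\<Oplus>j\<in>F. f j) = \<zero>"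
    using assms(6) F(1,3) unfolding F(4) by simp
  then have "(\<Oplus>j\<in>F. f j) \<oplus> f k = \<zero>"
    by (subst a_comm) auto
  then have "(\<Oplus>j\<in>F. f j) = \<ominus> f k"
    by (intro minus_equality[symmetric]) auto
  then have "(\<Oplus>j\<in>F. e \<ominus> f j) = complex_of_nat (card S - 1) \<odot> e \<oplus> f k"
    using *[OF F(1,2)] F(5) assms(3) by (simp add: minus_eq minus_minus)
  moreover have "nrm A (\<Oplus>j\<in>F. e \<ominus> f j) \<le> card F"
    using F(1,2) assms by (intro nrm_finsum_le) auto
  ultimately show ?thesis
    using F(5) by simp
qed

text \<open>Compressing the sum by \<open>e = p i\<close> shows that the
  \<open>h k = e p\<^sub>k e\<close> with \<open>k \<noteq> i\<close> add up to zero. Each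
  \<open>e - h k = e (1 - p\<^sub>k) e\<close> is a contraction, which takes the place of
  positivity. Both \<open>n e + h j\<close> and \<open>n e - h j\<close> then have norm at most
  \<open>n\<close>, so \<open>h j\<close> vanishes by the extremality of \<open>e\<close>; finally
  \<open>h j\<close> is \<open>x\<^sup>* x\<close> for \<open>x = p\<^sub>j e\<close>.\<close>

lemma projections_sum_one_orthogonal:
  assumes S: "finite S" "i \<in> S" "j \<in> S" "i \<noteq> j"
    and p: "\<And>k. k \<in> S \<Longrightarrow> projection A (p k)" and sum: "(\<Oplus>k\<in>S. p k) = \<one>"
  shows "p i \<otimes> p j = \<zero>"
proof -
  define e where "e = p i"
  define h where "h k = e \<otimes> p k \<otimes> e" for k
  define F where "F = S - {i}"
  have e: "projection A e"
    using p S by (simp add: e_def)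
  note [simp] = projectionD[OF e]
  have [simp]: "p k \<in> carrier A" "star A (p k) = p k" "p k \<otimes> p k = p k" if "k \<in> F" for k
    using p that projectionD by (auto simp: F_def)
  have F: "finite F" "S = insert i F" "i \<notin> F" "j \<in> F"
    using S by (auto simp: F_def)
  then have [simp]: "p \<in> F \<rightarrow> carrier A" "(\<lambda>k. e \<otimes> p k) \<in> F \<rightarrow> carrier A"
    by auto
  have "e \<oplus> (\<Oplus>k\<in>F. p k) = \<one>"
    using sum F by (simp add: e_def[symmetric])
  then have "e \<otimes> (e \<oplus> (\<Oplus>k\<in>F. p k)) \<otimes> e = e"
    by simp
  then have "e \<oplus> (\<Oplus>k\<in>F. h k) = e"
    using F(1) by (simp add: r_distr l_distr finsum_rdistr finsum_ldistr h_def)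
  moreover have "h \<in> F \<rightarrow> carrier A"
    by (auto simp: h_def)
  ultimately have sum_h: "(\<Oplus>k\<in>F. h k) = \<zero>"
    using add.r_cancel_one[of e "\<Oplus>k\<in>F. h k"] by simp
  have h_le: "nrm A (e \<ominus> h k) \<le> 1" if "k \<in> F" for k
  proof -
    have "e \<ominus> h k = e \<otimes> (\<one> \<ominus> p k) \<otimes> e"
      using that by (simp add: h_def minus_eq r_distr l_distr r_minus l_minus)
    moreover have "nrm A \<dots> \<le> nrm A e * nrm A (\<one> \<ominus> p k) * nrm A e"
      using that nrm_mult[of "e \<otimes> (\<one> \<ominus> p k)" e] nrm_mult[of e "\<one> \<ominus> p k"]
        mult_right_mono[OF nrm_mult[of e "\<one> \<ominus> p k"] nrm_nonneg[of e]] by simp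
    moreover have "nrm A e \<le> 1" "nrm A (\<one> \<ominus> p k) \<le> 1"
      using e p that F by (auto intro!: nrm_projection projection_one_minus)
    ultimately show ?thesis
      using that by (smt (verit) mult_le_one mult_nonneg_nonneg nrm_nonneg
          \<open>e \<in> carrier A\<close> minus_closed one_closed \<open>\<And>k. k \<in> F \<Longrightarrow> p k \<in> carrier A\<close>)
  qed
  define n where "n = real (card F)"
  have n: "n \<ge> 1"
    using F by (auto simp: n_def Suc_le_eq card_gt_0_iff)
  have hj [simp]: "h j \<in> carrier A"
    using F by (simp add: h_def)
  \<comment> \<open>One more summand \<open>e\<close> turns this estimate into the one for
    \<open>n e + h j\<close>. For the other sign, \<open>n e - h j\<close> is
    \<open>(n - 1) e\<close> plus the contraction \<open>e - h j\<close>.\<close>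
  have "nrm A (complex_of_nat (card F - 1) \<odot> e \<oplus> h j) \<le> card F - 1"
    using F h_le sum_h by (intro nrm_le_card_if_sum_eq_zero) (auto simp: h_def)
  then have "nrm A (e \<oplus> (complex_of_nat (card F - 1) \<odot> e \<oplus> h j)) \<le> 1 + (card F - 1)"
    using nrm_triangle[of e "complex_of_nat (card F - 1) \<odot> e \<oplus> h j"] nrm_projection[OF e] by simp
  also have "e \<oplus> (complex_of_nat (card F - 1) \<odot> e \<oplus> h j) = complex_of_real n \<odot> e \<oplus> h j"
    using smult_l_distr[of e 1 "complex_of_nat (card F - 1)"] n
    by (simp add: n_def smult_one a_assoc of_nat_diff)
  finally have plus: "nrm A (complex_of_real n \<odot> e \<oplus> h j) \<le> n"
    using n by (simp add: n_def of_nat_diff)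
  have "nrm A (complex_of_real (n - 1) \<odot> e \<oplus> (e \<ominus> h j)) \<le> (n - 1) * nrm A e + nrm A (e \<ominus> h j)"
    using n nrm_triangle[of "complex_of_real (n - 1) \<odot> e" "e \<ominus> h j"]
    by (simp add: nrm_smult del: of_real_diff)
  also have "\<dots> \<le> n"
    using h_le[OF F(4)] nrm_projection[OF e] n mult_left_mono[of "nrm A e" 1 "n - 1"] by simp
  also have "complex_of_real (n - 1) \<odot> e \<oplus> (e \<ominus> h j) = complex_of_real n \<odot> e \<ominus> h j"
    using smult_l_distr[of e "complex_of_real (n - 1)" 1]
    by (simp add: smult_one minus_eq a_assoc)
  finally have minus: "nrm A (complex_of_real n \<odot> e \<ominus> h j) \<le> n" .
  define g where "g = complex_of_real (1 / n) \<odot> h j"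
  have [simp]: "g \<in> carrier A"
    by (simp add: g_def)
  have n_inv: "complex_of_real (1 / n) \<odot> (complex_of_real n \<odot> e) = e"
    using n by (simp add: smult_one flip: smult_assoc)
  have "g = \<zero>"
  proof (rule selfadjoint_eq_zero_if_nrm_plus_minus_le[OF e])
    show "star A g = g" "e \<otimes> g = g"
      using F by (simp_all add: g_def h_def star_smult star_mult smult_mult_right m_assoc)
        (simp_all flip: m_assoc)
    have "e \<oplus> g = complex_of_real (1 / n) \<odot> (complex_of_real n \<odot> e \<oplus> h j)"
      by (simp only: n_inv smult_r_distr smult_closed hj \<open>e \<in> carrier A\<close> g_def)
    then show "nrm A (e \<oplus> g) \<le> 1"
      using plus n by (simp add: nrm_smult field_simps norm_divide)
    have "e \<ominus> g = complex_of_real (1 / n) \<odot> (complex_of_real n \<odot> e \<ominus> h j)"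
      using smult_mult_right[of "\<ominus> \<one>" "h j"] 
      by (simp add: minus_eq n_inv smult_r_distr g_def del: of_real_divide)
        (metis hj l_minus l_one one_closed a_inv_closed smult_mult_right smult_closed)
    then show "nrm A (e \<ominus> g) \<le> 1"
      using minus n by (simp add: nrm_smult field_simps norm_divide)
  qed auto
  then have "complex_of_real n \<odot> g = \<zero>"
    by simp
  then have "h j = \<zero>"
    using n by (simp add: g_def smult_one flip: smult_assoc)
  then have "star A (p j \<otimes> e) \<otimes> (p j \<otimes> e) = \<zero>"
    using F m_assoc[of "e \<otimes> p j" "p j" e] m_assoc[of e "p j" "p j"] by (simp add: h_def star_mult)
  then have "p j \<otimes> e = \<zero>"
    using F star_mult_self_eq_zero[of "p j \<otimes> e"] by simp
  then have "star A (p j \<otimes> e) = \<zero>"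
    by simp
  then show ?thesis
    using F by (simp add: star_mult e_def[symmetric])
qed

end

section \<open>Words of partial isometries\<close>

context unital_cstar_algebra
begin

text \<open>Multiply \<open>x\<close> by the sum of the \<open>q t\<close>: only the term with index
  \<open>j\<close> survives.\<close>

lemma sum_one_absorb_right:
  assumes S: "finite S" "j \<in> S" and q: "\<And>t. t \<in> S \<Longrightarrow> q t \<in> carrier A"
    and sum: "(\<Oplus>t\<in>S. q t) = \<one>" and x: "x \<in> carrier A"
    and "\<And>t. t \<in> S \<Longrightarrow> t \<noteq> j \<Longrightarrow> x \<otimes> q t = \<zero>"
  shows "x \<otimes> q j = x"
proof -
  have "x = x \<otimes> (\<Oplus>t\<in>S. q t)"
    using sum x by simp
  also have "\<dots> = (\<Oplus>t\<in>S. x \<otimes> q t)"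
    using S q x by (intro finsum_rdistr) auto
  also have "\<dots> = (\<Oplus>t\<in>S. if j = t then x \<otimes> q t else \<zero>)"
    using assms by (intro finsum_cong') auto
  also have "\<dots> = x \<otimes> q j"
    using S q x by (intro finsum_singleton) auto
  finally show ?thesis
    by simp
qed

lemma sum_one_absorb_left:
  assumes S: "finite S" "j \<in> S" and q: "\<And>t. t \<in> S \<Longrightarrow> q t \<in> carrier A"
    and sum: "(\<Oplus>t\<in>S. q t) = \<one>" and x: "x \<in> carrier A"
    and "\<And>t. t \<in> S \<Longrightarrow> t \<noteq> j \<Longrightarrow> q t \<otimes> x = \<zero>"
  shows "q j \<otimes> x = x"
proof -
  have "x = (\<Oplus>t\<in>S. q t) \<otimes> x"
    using sum x by simp
  also have "\<dots> = (\<Oplus>t\<in>S. q t \<otimes> x)"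
    using S q x by (intro finsum_ldistr) auto
  also have "\<dots> = (\<Oplus>t\<in>S. if j = t then q t \<otimes> x else \<zero>)"
    using assms by (intro finsum_cong') auto
  also have "\<dots> = q j \<otimes> x"
    using S q x by (intro finsum_singleton) auto
  finally show ?thesis
    by simp
qed

lemma partial_isometryD:
  assumes "partial_isometry A x"
  shows "x \<in> carrier A" "x \<otimes> star A x \<otimes> x = x" "star A x \<otimes> x \<otimes> star A x = star A x"
    "projection A (star A x \<otimes> x)" "projection A (x \<otimes> star A x)"
proof -
  show x: "x \<in> carrier A" and *: "x \<otimes> star A x \<otimes> x = x"
    using assms by (auto simp: partial_isometry_def)
  have "star A (x \<otimes> star A x \<otimes> x) = star A x"
    by (simp only: *)
  then show **: "star A x \<otimes> x \<otimes> star A x = star A x"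
    using x by (simp add: star_mult m_assoc)
  have "star A x \<otimes> x \<otimes> (star A x \<otimes> x) = star A x \<otimes> x \<otimes> star A x \<otimes> x"
    "x \<otimes> star A x \<otimes> (x \<otimes> star A x) = x \<otimes> star A x \<otimes> x \<otimes> star A x"
    using x by (simp_all add: m_assoc)
  then show "projection A (star A x \<otimes> x)" "projection A (x \<otimes> star A x)"
    using x by (simp_all add: projection_def star_mult * **)
qed

lemma partial_isometry_star: "partial_isometry A x \<Longrightarrow> partial_isometry A (star A x)"
  using partial_isometryD(1,3)[of x] by (simp add: partial_isometry_def)

text \<open>For \<open>d = (1 - p) q p\<close>, idempotency of \<open>q p\<close> gives
  \<open>d\<^sup>* d = p q p - p q p q p = 0\<close>. Hence \<open>q p = p q p\<close>, which is
  self-adjoint, so \<open>q p\<close> equals its adjoint \<open>p q\<close>.\<close>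

lemma projections_commute:
  assumes q: "projection A q" and p: "projection A p" and idem: "q \<otimes> p \<otimes> (q \<otimes> p) = q \<otimes> p"
  shows "q \<otimes> p = p \<otimes> q"
proof -
  note [simp] = projectionD[OF q] projectionD[OF p]
  have p': "projection A (\<one> \<ominus> p)"
    by (rule projection_one_minus[OF p])
  note [simp] = projectionD[OF p']
  have pqp: "p \<otimes> q \<otimes> (p \<otimes> (q \<otimes> p)) = p \<otimes> q \<otimes> p" 
    using idem by (simp add: m_assoc)
  define d where "d = (\<one> \<ominus> p) \<otimes> (q \<otimes> p)"
  have [simp]: "d \<in> carrier A"
    by (simp add: d_def)
  have d: "d = q \<otimes> p \<ominus> p \<otimes> (q \<otimes> p)"
    by (simp add: d_def minus_eq l_distr l_minus)
  have "star A d \<otimes> d = p \<otimes> q \<otimes> ((\<one> \<ominus> p) \<otimes> (\<one> \<ominus> p)) \<otimes> (q \<otimes> p)"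
    unfolding d_def by (simp add: star_mult m_assoc del: projectionD(3)[OF p'])
  also have "\<dots> = p \<otimes> q \<otimes> d"
    by (simp add: d_def m_assoc)
  also have "\<dots> = p \<otimes> q \<otimes> (q \<otimes> p) \<ominus> p \<otimes> q \<otimes> (p \<otimes> (q \<otimes> p))"
    unfolding d by (simp add: minus_eq r_distr r_minus)
  also have "p \<otimes> q \<otimes> (q \<otimes> p) = p \<otimes> (q \<otimes> q) \<otimes> p"
    by (simp add: m_assoc del: projectionD(3)[OF q])
  finally have "star A d \<otimes> d = \<zero>"
    by (simp add: pqp minus_eq r_neg)
  then have "d = \<zero>"
    by (rule star_mult_self_eq_zero[rotated]) simp
  then have *: "q \<otimes> p = p \<otimes> (q \<otimes> p)"
    using d minus_equality[of "q \<otimes> p" "\<ominus> (p \<otimes> (q \<otimes> p))"]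
    by (simp add: minus_eq minus_minus)
  then have "star A (q \<otimes> p) = star A (p \<otimes> (q \<otimes> p))"
    by (rule arg_cong)
  then have "p \<otimes> q = p \<otimes> (q \<otimes> p)"
    by (simp add: star_mult m_assoc)
  with * show ?thesis
    by (rule trans[OF _ sym])
qed

text \<open>Multiplying the identity that makes \<open>x y\<close> a partial isometry by
  \<open>x\<^sup>*\<close> on the left and \<open>y\<^sup>*\<close> on the right shows that the
  product of the two projections is idempotent.\<close>

lemma partial_isometry_mult_commute:
  assumes x: "partial_isometry A x" and y: "partial_isometry A y"
    and xy: "partial_isometry A (x \<otimes> y)"
  shows "star A x \<otimes> x \<otimes> (y \<otimes> star A y) = y \<otimes> star A y \<otimes> (star A x \<otimes> x)"
proof (rule projections_commute)
  note [simp] = partial_isometryD(1)[OF x] partial_isometryD(1)[OF y]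
  have "star A x \<otimes> x \<otimes> (y \<otimes> star A y) \<otimes> (star A x \<otimes> x \<otimes> (y \<otimes> star A y)) =
    star A x \<otimes> (x \<otimes> y \<otimes> star A (x \<otimes> y) \<otimes> (x \<otimes> y)) \<otimes> star A y"
    by (simp add: star_mult m_assoc)
  also have "\<dots> = star A x \<otimes> x \<otimes> (y \<otimes> star A y)"
    using partial_isometryD(2)[OF xy] by (simp add: m_assoc)
  finally show "star A x \<otimes> x \<otimes> (y \<otimes> star A y) \<otimes> (star A x \<otimes> x \<otimes> (y \<otimes> star A y)) =
    star A x \<otimes> x \<otimes> (y \<otimes> star A y)" .
qed (use partial_isometryD x y in auto)

text \<open>The converse of the preceding fact: exchanging the two inner projections in
  \<open>x y y\<^sup>* x\<^sup>* x y\<close> leaves \<open>x x\<^sup>* x\<close> times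
  \<open>y y\<^sup>* y\<close>.\<close>

lemma partial_isometry_mult:
  assumes x: "partial_isometry A x" and y: "partial_isometry A y"
    and comm: "star A x \<otimes> x \<otimes> (y \<otimes> star A y) = y \<otimes> star A y \<otimes> (star A x \<otimes> x)"
  shows "partial_isometry A (x \<otimes> y)"
proof -
  note [simp] = partial_isometryD(1)[OF x] partial_isometryD(1)[OF y]
  have "x \<otimes> y \<otimes> star A (x \<otimes> y) \<otimes> (x \<otimes> y) =
      x \<otimes> (y \<otimes> star A y \<otimes> (star A x \<otimes> x)) \<otimes> y"
    by (simp add: star_mult m_assoc)
  also have "\<dots> = (x \<otimes> star A x \<otimes> x) \<otimes> (y \<otimes> star A y \<otimes> y)"
    by (simp add: m_assoc flip: comm)
  also have "\<dots> = x \<otimes> y"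
    by (simp only: partial_isometryD(2)[OF x] partial_isometryD(2)[OF y])
  finally show ?thesis
    by (simp add: partial_isometry_def)
qed

section \<open>Products of words\<close>

lemma prod_word_Nil [simp]: "prod_word A [] = \<one>"
  and prod_word_Cons [simp]: "prod_word A (x # xs) = x \<otimes> prod_word A xs"
  by (simp_all add: prod_word_def)

lemma prod_word_closed [simp]: "set xs \<subseteq> carrier A \<Longrightarrow> prod_word A xs \<in> carrier A"
  by (induction xs) auto

lemma prod_word_append:
  "set xs \<subseteq> carrier A \<Longrightarrow> set ys \<subseteq> carrier A \<Longrightarrow>
    prod_word A (xs @ ys) = prod_word A xs \<otimes> prod_word A ys"
  by (induction xs) (auto simp: m_assoc)

lemma star_prod_word:
  "set xs \<subseteq> carrier A \<Longrightarrow> star A (prod_word A xs) = prod_word A (rev (map (star A) xs))"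
proof (induction xs)
  case (Cons x xs)
  moreover from Cons have "star A ` set xs \<subseteq> carrier A"
    by auto
  ultimately show ?case
    by (simp add: star_mult prod_word_append)
qed simp

text \<open>
  If the product of the tails does not vanish, then both tails are equal to some \<open>w\<close>, and the
  product is \<open>x w w\<^sup>* y\<^sup>*\<close> with \<open>x y\<^sup>* = 0\<close>; since \<open>x w\<close> is a partial isometry, \<open>x\<^sup>* x\<close> can be moved
  past \<open>w w\<^sup>*\<close>.
\<close>

lemma prod_word_orthogonal:
  assumes "list_all2 (\<lambda>x y. x = y \<or> x \<otimes> star A y = \<zero>) xs ys"
    and "set xs \<subseteq> carrier A" "set ys \<subseteq> carrier A"
    and "\<And>us ws. xs = us @ ws \<Longrightarrow> partial_isometry A (prod_word A ws)"
    and "\<And>x. x \<in> set xs \<Longrightarrow> partial_isometry A x"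
    and "\<exists>(x, y) \<in> set (zip xs ys). x \<otimes> star A y = \<zero>"
  shows "prod_word A xs \<otimes> star A (prod_word A ys) = \<zero>"
  using assms
proof (induction xs ys rule: list_all2_induct)
  case (Cons x xs y ys)
  have [simp]: "x \<in> carrier A" "y \<in> carrier A" "set xs \<subseteq> carrier A" "set ys \<subseteq> carrier A"
    using Cons.prems by auto
  define w where "w = prod_word A xs"
  have [simp]: "w \<in> carrier A"
    by (simp add: w_def)
  have prod: "prod_word A (x # xs) \<otimes> star A (prod_word A (y # ys)) =
      x \<otimes> (w \<otimes> star A (prod_word A ys)) \<otimes> star A y"
    by (simp add: star_mult m_assoc w_def)
  show ?case
  proof (cases "\<exists>(x, y) \<in> set (zip xs ys). x \<otimes> star A y = \<zero>")
    case True
    have "w \<otimes> star A (prod_word A ys) = \<zero>"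
      unfolding w_def
    proof (rule Cons.IH)
      show "partial_isometry A (prod_word A ws)" if "xs = us @ ws" for us ws
        using that Cons.prems(3)[of "x # us" ws] by simp
    qed (use True Cons.prems in auto)
    then show ?thesis
      using prod by simp
  next
    case False
    then have xy: "x \<otimes> star A y = \<zero>"
      using Cons.prems by auto
    have "list_all2 (=) xs ys"
      using False Cons.hyps(2) by (auto simp: list_all2_iff)
    then have ys: "prod_word A ys = w"
      by (simp add: w_def list.rel_eq)
    have x: "partial_isometry A x" and w: "partial_isometry A w" and xw: "partial_isometry A (x \<otimes> w)"
      using Cons.prems(4) Cons.prems(3)[of "[x]" xs] Cons.prems(3)[of "[]" "x # xs"]
      by (auto simp: w_def)
    have "x \<otimes> (w \<otimes> star A w) \<otimes> star A y = (x \<otimes> star A x \<otimes> x) \<otimes> (w \<otimes> star A w) \<otimes> star A y"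
      using partial_isometryD(2)[OF x] by simp
    also have "\<dots> = x \<otimes> (star A x \<otimes> x \<otimes> (w \<otimes> star A w)) \<otimes> star A y"
      by (simp add: m_assoc)
    also have "\<dots> = x \<otimes> (w \<otimes> star A w) \<otimes> star A x \<otimes> (x \<otimes> star A y)"
      using partial_isometry_mult_commute[OF x w xw] by (simp add: m_assoc)
    finally show ?thesis
      using prod by (simp add: ys xy)
  qed
qed simp

end

section \<open>Equivalence of the relations\<close>

text \<open>The two sides of the relation coincide unless exactly one of \<open>I = S\<close> and
  \<open>J = T\<close> holds, and in that case one side is zero. The relation is proved and applied
  in this form.\<close>

lemma word_relation_iff:
  "word_relation N A k x y \<longleftrightarrow>
     (\<forall>I J S T. length I = k \<and> length J = k \<and> length S = k \<and> length T = k \<and>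
        set I \<subseteq> {1..N} \<and> set J \<subseteq> {1..N} \<and> set S \<subseteq> {1..N} \<and> set T \<subseteq> {1..N} \<and>
        (I = S) \<noteq> (J = T) \<longrightarrow>
        prod_word A (map2 x I J @ rev (map2 y S T)) = \<zero>\<^bsub>A\<^esub>)"
proof -
  have "((if b then z else w) = (if a then z else w)) \<longleftrightarrow> (a \<noteq> b \<longrightarrow> z = w)" for a b and z w :: 'a
    by auto
  then show ?thesis
    unfolding word_relation_def Let_def by (simp only: conj_assoc) blast
qed

lemma set_map2_subset:
  assumes "\<And>i j. i \<in> X \<Longrightarrow> j \<in> Y \<Longrightarrow> f i j \<in> Z" "set xs \<subseteq> X" "set ys \<subseteq> Y"
  shows "set (map2 f xs ys) \<subseteq> Z"
  using assms by (auto elim!: in_set_zipE)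

lemma map_map2: "map f (map2 g xs ys) = map2 (\<lambda>x y. f (g x y)) xs ys"
  by (simp add: case_prod_beta)

lemma rev_map2: "length xs = length ys \<Longrightarrow> rev (map2 f xs ys) = map2 f (rev xs) (rev ys)"
  by (simp add: zip_rev rev_map)

context unital_cstar_algebra
begin

section \<open>Words in matrix entries and in their adjoints\<close>

lemma star_prod_word_rev:
  "set xs \<subseteq> carrier A \<Longrightarrow> star A (prod_word A (rev xs)) = prod_word A (map (star A) xs)"
  by (simp add: star_prod_word rev_map)

context
  fixes N :: nat and v :: "nat \<Rightarrow> nat \<Rightarrow> 'a"
  assumes v: "matrix_in N A v"
begin

lemma matrix_entry_closed: "i \<in> {1..N} \<Longrightarrow> j \<in> {1..N} \<Longrightarrow> v i j \<in> carrier A"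
  using v by (simp add: matrix_in_def)

lemma word_closed:
  assumes "set I \<subseteq> {1..N}" "set J \<subseteq> {1..N}"
  shows "set (map2 v I J) \<subseteq> carrier A" "set (map2 (conj_matrix A v) I J) \<subseteq> carrier A"
  by (rule set_map2_subset[OF _ assms]; simp add: matrix_entry_closed conj_matrix_def)+

text \<open>The reversed word of adjoints is the adjoint of a word, so the relation for a white word
  concerns products \<open>x y\<^sup>*\<close> of two words \<open>x\<close> and \<open>y\<close> in
  the entries of \<open>v\<close>.\<close>

lemma word_times_rev_conj_word:
  assumes "set I \<subseteq> {1..N}" "set J \<subseteq> {1..N}" "set S \<subseteq> {1..N}" "set T \<subseteq> {1..N}"
  shows "prod_word A (map2 v I J @ rev (map2 (conj_matrix A v) S T)) =
      prod_word A (map2 v I J) \<otimes> star A (prod_word A (map2 v S T))"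
  using word_closed[OF assms(1,2)] word_closed[OF assms(3,4)]
  by (simp add: prod_word_append star_prod_word map_map2 conj_matrix_def[abs_def] del: map_map)

text \<open>The reversal caused by the star is put on the indices, so that what holds for all words
  in \<open>v\<close> carries over to words in the adjoints.\<close>

lemma prod_conj_word:
  assumes "length I = length J" "set I \<subseteq> {1..N}" "set J \<subseteq> {1..N}"
  shows "prod_word A (map2 (conj_matrix A v) I J) = star A (prod_word A (map2 v (rev I) (rev J)))"
proof -
  have "map2 (conj_matrix A v) I J = map (star A) (map2 v I J)"
    by (simp add: map_map2 conj_matrix_def[abs_def] del: map_map)
  also have "prod_word A \<dots> = star A (prod_word A (rev (map2 v I J)))"
    by (rule star_prod_word_rev[OF word_closed(1)[OF assms(2,3)], symmetric])
  also have "rev (map2 v I J) = map2 v (rev I) (rev J)"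
    by (rule rev_map2[OF assms(1)])
  finally show ?thesis .
qed

end

lemma matrix_in_conj: "matrix_in N A v \<Longrightarrow> matrix_in N A (conj_matrix A v)"
  by (simp add: matrix_in_def conj_matrix_def)

text \<open>The analogous formula for black words. Conjugating twice is known to return
  \<open>v\<close> only on indices in the range, hence the comparison of the words letter by
  letter.\<close>

lemma conj_word_times_rev_word:
  assumes "matrix_in N A v"
    and "set I \<subseteq> {1..N}" "set J \<subseteq> {1..N}" "set S \<subseteq> {1..N}" "set T \<subseteq> {1..N}"
  shows "prod_word A (map2 (conj_matrix A v) I J @ rev (map2 v S T)) =
      prod_word A (map2 (conj_matrix A v) I J) \<otimes> star A (prod_word A (map2 (conj_matrix A v) S T))"
proof -
  have "map2 (conj_matrix A (conj_matrix A v)) S T = map2 v S T"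
    using assms(4,5) by (intro map_cong refl)
      (auto simp: conj_matrix_def subset_iff matrix_entry_closed[OF assms(1)] elim!: in_set_zipE)
  then show ?thesis
    using word_times_rev_conj_word[OF matrix_in_conj[OF assms(1)] assms(2-)] by (simp only:)
qed

text \<open>Letterwise orthogonality is lifted to words. The matrix \<open>v\<close> is generic, so
  that the lemma yields the white relations and, applied to the matrix of adjoints, the black
  ones.\<close>

lemma word_relation_if_partial_isometries:
  assumes v: "matrix_in N A v"
    and pi: "\<And>I J. length I = length J \<Longrightarrow> length I \<le> k \<Longrightarrow> set I \<subseteq> {1..N} \<Longrightarrow>
      set J \<subseteq> {1..N} \<Longrightarrow> partial_isometry A (prod_word A (map2 v I J))"
    and orth: "\<And>i j s t. i \<in> {1..N} \<Longrightarrow> j \<in> {1..N} \<Longrightarrow> s \<in> {1..N} \<Longrightarrow> t \<in> {1..N} \<Longrightarrow>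
      (i = s) \<noteq> (j = t) \<Longrightarrow> v i j \<otimes> star A (v s t) = \<zero>"
    and IJ: "length I = k" "length J = k" "length S = k" "length T = k"
      "set I \<subseteq> {1..N}" "set J \<subseteq> {1..N}" "set S \<subseteq> {1..N}" "set T \<subseteq> {1..N}"
    and neq: "(I = S) \<noteq> (J = T)"
  shows "prod_word A (map2 v I J) \<otimes> star A (prod_word A (map2 v S T)) = \<zero>"
proof (rule prod_word_orthogonal)
  have in_range: "I ! m \<in> {1..N}" "J ! m \<in> {1..N}" "S ! m \<in> {1..N}" "T ! m \<in> {1..N}"
    if "m < k" for m
    using that IJ(1-4) IJ(5-8)[THEN subsetD, OF nth_mem] by simp_all
  show "list_all2 (\<lambda>x y. x = y \<or> x \<otimes> star A y = \<zero>) (map2 v I J) (map2 v S T)"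
  proof (rule list_all2_all_nthI)
    fix m assume "m < length (map2 v I J)"
    then have m: "m < k"
      using IJ by simp
    \<comment> \<open>One of the two pairs of index words agrees entirely, so at no position do both
      indices differ; that case would not be covered by \<open>orth\<close>.\<close>
    have "I ! m = S ! m \<and> J ! m = T ! m \<or> (I ! m = S ! m) \<noteq> (J ! m = T ! m)"
      using neq by auto
    then show "map2 v I J ! m = map2 v S T ! m \<or>
        map2 v I J ! m \<otimes> star A (map2 v S T ! m) = \<zero>"
      using m IJ orth[OF in_range[OF m]] by auto
  qed (use IJ in simp)
  have "\<exists>m<k. (I ! m = S ! m) \<noteq> (J ! m = T ! m)"
  proof (rule ccontr)
    assume "\<not> ?thesis"
    then have *: "I ! m = S ! m \<longleftrightarrow> J ! m = T ! m" if "m < k" for m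
      using that by blast
    have "I = S \<longleftrightarrow> J = T"
      using IJ * by (auto simp: list_eq_iff_nth_eq)
    with neq show False
      by blast
  qed
  then obtain m where m: "m < k" "(I ! m = S ! m) \<noteq> (J ! m = T ! m)"
    by blast
  have "zip (map2 v I J) (map2 v S T) ! m \<in> set (zip (map2 v I J) (map2 v S T))"
    using m IJ by (intro nth_mem) simp
  then have "(map2 v I J ! m, map2 v S T ! m) \<in> set (zip (map2 v I J) (map2 v S T))"
    using m IJ by (subst (asm) nth_zip) simp_all
  moreover have "map2 v I J ! m \<otimes> star A (map2 v S T ! m) = \<zero>"
    using m IJ orth[OF in_range[OF m(1)]] by auto
  ultimately show "\<exists>(x, y) \<in> set (zip (map2 v I J) (map2 v S T)). x \<otimes> star A y = \<zero>"
    by auto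
  show "partial_isometry A (prod_word A ws)" if "map2 v I J = us @ ws" for us ws
  proof -
    have "ws = drop (length us) (map2 v I J)"
      using that by simp
    also have "\<dots> = map2 v (drop (length us) I) (drop (length us) J)"
      by (simp add: drop_map drop_zip)
    finally show ?thesis
      using IJ pi[of "drop (length us) I" "drop (length us) J"] by (auto dest: in_set_dropD)
  qed
  show "partial_isometry A x" if "x \<in> set (map2 v I J)" for x
  proof -
    obtain m where m: "m < k" "x = v (I ! m) (J ! m)"
      using \<open>x \<in> set (map2 v I J)\<close> IJ by (auto simp: in_set_zip)
    then show ?thesis
      using pi[of "[I ! m]" "[J ! m]"] in_range[OF m(1)] matrix_entry_closed[OF v] by auto
  qed
qed (use word_closed[OF v] IJ in auto)

section \<open>From partial isometries to the hyperoctahedral relations\<close>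

lemma G_relations_imp_H_relations:
  assumes v: "matrix_in N A v" and G: "G_relations N M L A v"
  shows "H_relations N L A v"
proof -
  let ?R = "{1..N}"
  note vc [simp] = matrix_entry_closed[OF v]
  have pi: "partial_isometry A (v i j)" if "i \<in> ?R" "j \<in> ?R" for i j
    using G that by (simp add: G_relations_def Let_def)
  have p: "magic_unitary N A (range_proj A v)" and q: "magic_unitary N A (source_proj A v)"
    using G by (simp_all add: G_relations_def Let_def)
  \<comment> \<open>Condition (III) starts at length 1. The empty word, whose product is the unit,
    is added because it occurs as a tail of every word.\<close>
  have word: "partial_isometry A (prod_word A (map2 v I J))"
    if "length I = length J" "enat (length I) \<le> L" "set I \<subseteq> ?R" "set J \<subseteq> ?R" for I J
  proof (cases "I = []")
    case True
    then show ?thesis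
      by (simp add: partial_isometry_def)
  next
    case False
    then have "1 \<le> length I"
      by (cases I) auto
    then show ?thesis
      using G that by (simp add: G_relations_def Let_def)
  qed
  have len: "enat n \<le> L" if "enat k \<le> L" "n \<le> k" for n k
    using that by (meson enat_ord_simps(1) order_trans)
  have word_conj: "partial_isometry A (prod_word A (map2 (conj_matrix A v) I J))"
    if IJ: "length I = length J" "enat (length I) \<le> L" "set I \<subseteq> ?R" "set J \<subseteq> ?R" for I J
  proof -
    have "partial_isometry A (prod_word A (map2 v (rev I) (rev J)))"
      by (rule word) (use IJ in simp_all)
    then show ?thesis
      unfolding prod_conj_word[OF v IJ(1,3,4)] by (rule partial_isometry_star)
  qed
  have magic_orth: "r i j \<otimes> r s t = \<zero>"
    if "magic_unitary N A r" "i \<in> ?R" "j \<in> ?R" "s \<in> ?R" "t \<in> ?R" "(i = s) \<noteq> (j = t)" for r i j s t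
  proof (cases "i = s")
    case True
    then show ?thesis
      using that projections_sum_one_orthogonal[of ?R j t "\<lambda>j. r i j"]
      by (auto simp: magic_unitary_def)
  next
    case False
    then show ?thesis
      using that projections_sum_one_orthogonal[of ?R i s "\<lambda>i. r i j"]
      by (auto simp: magic_unitary_def)
  qed
  have orth: "v i j \<otimes> star A (v s t) = \<zero>"
    and orth_star: "star A (v i j) \<otimes> v s t = \<zero>"
    if r: "i \<in> ?R" "j \<in> ?R" "s \<in> ?R" "t \<in> ?R" and neq: "(i = s) \<noteq> (j = t)" for i j s t
  proof -
    note [simp] = vc[OF r(1,2)] vc[OF r(3,4)]
    let ?x = "v i j" and ?y = "v s t"
    note x = partial_isometryD[OF pi[OF r(1,2)]] and y = partial_isometryD[OF pi[OF r(3,4)]]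
    \<comment> \<open>Inserting the source projections of both entries reduces the claim to their
      orthogonality; the range projections serve in the same way below.\<close>
    have "?x \<otimes> star A ?y = (?x \<otimes> star A ?x \<otimes> ?x) \<otimes> (star A ?y \<otimes> ?y \<otimes> star A ?y)"
      by (simp only: x(2) y(3))
    also have "\<dots> = ?x \<otimes> (source_proj A v i j \<otimes> source_proj A v s t) \<otimes> star A ?y"
      by (simp add: source_proj_def m_assoc)
    finally show "?x \<otimes> star A ?y = \<zero>"
      using magic_orth[OF q r neq] by simp
    have "star A ?x \<otimes> ?y = (star A ?x \<otimes> ?x \<otimes> star A ?x) \<otimes> (?y \<otimes> star A ?y \<otimes> ?y)"
      by (simp only: x(3) y(2))
    also have "\<dots> = star A ?x \<otimes> (range_proj A v i j \<otimes> range_proj A v s t) \<otimes> ?y"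
      by (simp add: range_proj_def m_assoc)
    finally show "star A ?x \<otimes> ?y = \<zero>"
      using magic_orth[OF p r neq] by simp
  qed
  have orth_conj: "conj_matrix A v i j \<otimes> star A (conj_matrix A v s t) = \<zero>"
    if r: "i \<in> ?R" "j \<in> ?R" "s \<in> ?R" "t \<in> ?R" "(i = s) \<noteq> (j = t)" for i j s t
    unfolding conj_matrix_def star_star[OF vc[OF r(3,4)]] by (rule orth_star[OF r])
  \<comment> \<open>The row and column sums of range and source projections are the diagonal entries
    in the four unitarity equations; off the diagonal each summand vanishes by
    orthogonality.\<close>
  have sums: "(\<Oplus>k\<in>?R. v i k \<otimes> star A (v i k)) = \<one>" "(\<Oplus>k\<in>?R. star A (v k i) \<otimes> v k i) = \<one>"
    "(\<Oplus>k\<in>?R. star A (v i k) \<otimes> v i k) = \<one>" "(\<Oplus>k\<in>?R. v k i \<otimes> star A (v k i)) = \<one>"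
    if "i \<in> ?R" for i
    using p q that by (auto simp: magic_unitary_def range_proj_def source_proj_def)
  have sum0: "(\<Oplus>k\<in>?R. f k) = \<zero>" if "\<And>k. k \<in> ?R \<Longrightarrow> f k = \<zero>" for f
  proof -
    have "(\<Oplus>k\<in>?R. f k) = (\<Oplus>k\<in>?R. \<zero>)"
      using that by (intro finsum_cong') auto
    then show ?thesis
      by simp
  qed
  have "unitary_matrix N A v"
    unfolding unitary_matrix_def
  proof (intro ballI conjI)
    fix i j assume ij: "i \<in> ?R" "j \<in> ?R"
    have "v i k \<otimes> star A (v j k) = \<zero>" "star A (v k i) \<otimes> v k j = \<zero>"
      if "i \<noteq> j" "k \<in> ?R" for k
      using that ij by (auto intro: orth orth_star)
    then show "(\<Oplus>k\<in>?R. v i k \<otimes> star A (v j k)) = (if i = j then \<one> else \<zero>)"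
      "(\<Oplus>k\<in>?R. star A (v k i) \<otimes> v k j) = (if i = j then \<one> else \<zero>)"
      using sums(1,2)[OF ij(2)] sum0 by simp_all
  qed
  moreover have "unitary_matrix N A (conj_matrix A v)"
    unfolding unitary_matrix_def conj_matrix_def
  proof (intro ballI conjI)
    fix i j assume ij: "i \<in> ?R" "j \<in> ?R"
    have *: "star A (v i k) \<otimes> v j k = \<zero>" "v k i \<otimes> star A (v k j) = \<zero>"
      if "i \<noteq> j" "k \<in> ?R" for k
      using that ij by (auto intro: orth orth_star)
    have "(\<Oplus>k\<in>?R. star A (v i k) \<otimes> star A (star A (v j k))) = (\<Oplus>k\<in>?R. star A (v i k) \<otimes> v j k)"
      "(\<Oplus>k\<in>?R. star A (star A (v k i)) \<otimes> star A (v k j)) = (\<Oplus>k\<in>?R. v k i \<otimes> star A (v k j))"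
      using ij by (auto intro!: finsum_cong')
    then show "(\<Oplus>k\<in>?R. star A (v i k) \<otimes> star A (star A (v j k))) = (if i = j then \<one> else \<zero>)"
      "(\<Oplus>k\<in>?R. star A (star A (v k i)) \<otimes> star A (v k j)) = (if i = j then \<one> else \<zero>)"
      using sums(3,4)[OF ij(2)] sum0 * by simp_all
  qed
  moreover have "word_relation N A k v (conj_matrix A v)" if "enat k \<le> L" for k
    unfolding word_relation_iff
  proof (intro allI impI, elim conjE)
    fix I J S T
    assume IJ: "length I = k" "length J = k" "length S = k" "length T = k"
      "set I \<subseteq> ?R" "set J \<subseteq> ?R" "set S \<subseteq> ?R" "set T \<subseteq> ?R" "(I = S) \<noteq> (J = T)"
    have "prod_word A (map2 v I J) \<otimes> star A (prod_word A (map2 v S T)) = \<zero>"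
      using word_relation_if_partial_isometries[OF v word orth IJ] len[OF \<open>enat k \<le> L\<close>] by blast
    then show "prod_word A (map2 v I J @ rev (map2 (conj_matrix A v) S T)) = \<zero>"
      by (rule trans[OF word_times_rev_conj_word[OF v IJ(5-8)]])
  qed
  moreover have "word_relation N A k (conj_matrix A v) v" if "enat k \<le> L" for k
    unfolding word_relation_iff
  proof (intro allI impI, elim conjE)
    fix I J S T
    assume IJ: "length I = k" "length J = k" "length S = k" "length T = k"
      "set I \<subseteq> ?R" "set J \<subseteq> ?R" "set S \<subseteq> ?R" "set T \<subseteq> ?R" "(I = S) \<noteq> (J = T)"
    have "prod_word A (map2 (conj_matrix A v) I J) \<otimes>
        star A (prod_word A (map2 (conj_matrix A v) S T)) = \<zero>"
      using word_relation_if_partial_isometries[OF matrix_in_conj[OF v] word_conj orth_conj IJ]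
        len[OF \<open>enat k \<le> L\<close>] by blast
    then show "prod_word A (map2 (conj_matrix A v) I J @ rev (map2 v S T)) = \<zero>"
      by (rule trans[OF conj_word_times_rev_word[OF v IJ(5-8)]])
  qed
  ultimately show ?thesis
    unfolding H_relations_def by blast
qed

end

section \<open>From the hyperoctahedral relations to partial isometries\<close>

lemma perron_frobenius_all_ones:
  assumes "perron_frobenius_vector N all_ones \<omega>" and i: "i \<in> {1..N}" and j: "j \<in> {1..N}"
  shows "\<omega> i = \<omega> j"
proof -
  obtain r where pos: "\<And>k. k \<in> {1..N} \<Longrightarrow> \<omega> k > 0"
    and r: "\<And>k. k \<in> {1..N} \<Longrightarrow> sum \<omega> {1..N} = r * \<omega> k"
    using assms(1) unfolding perron_frobenius_vector_def all_ones_def of_real_1 mult_1_left by blast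
  \<comment> \<open>Every coordinate of the all-ones matrix applied to \<open>\<omega>\<close> is
    the total of \<open>\<omega>\<close>. Its positivity excludes \<open>r = 0\<close>, so that
    \<open>r\<close> can be cancelled.\<close>
  have "sum \<omega> {1..N} > 0"
    using i pos by (intro sum_pos) auto
  then have "r \<noteq> 0"
    using r[OF i] by auto
  then show ?thesis
    using r[OF i] r[OF j] by simp
qed

context unital_cstar_algebra
begin

lemma smult_finsum:
  assumes "finite S" "\<And>k. k \<in> S \<Longrightarrow> f k \<in> carrier A"
  shows "(\<Oplus>k\<in>S. c \<odot> f k) = c \<odot> (\<Oplus>k\<in>S. f k)"
  using assms
proof (induction S rule: finite_induct)
  case (insert k S)
  then have "f \<in> S \<rightarrow> carrier A"
    by auto
  then show ?case
    using insert by (auto simp: smult_r_distr Pi_def)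
qed simp

text \<open>
  In the induction step, \<open>Q t = v\<^sub>i\<^sub>t\<^sup>* v\<^sub>i\<^sub>t\<close> sums to \<open>1\<close> over \<open>t\<close> and the relation says that
  \<open>Q j P Q t = 0\<close> for \<open>t \<noteq> j\<close>, where \<open>P\<close> is the range projection of the tail. Hence
  \<open>Q j P = Q j P Q j = P Q j\<close>.
\<close>

lemma H_relations_imp_word_partial_isometry:
  assumes v: "matrix_in N A v" and H: "H_relations N L A v"
    and pi: "\<And>i j. i \<in> {1..N} \<Longrightarrow> j \<in> {1..N} \<Longrightarrow> partial_isometry A (v i j)"
    and q: "\<And>i. i \<in> {1..N} \<Longrightarrow> (\<Oplus>j\<in>{1..N}. star A (v i j) \<otimes> v i j) = \<one>"
    and IJ: "length I = length J" "enat (length I) \<le> L" "set I \<subseteq> {1..N}" "set J \<subseteq> {1..N}"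
  shows "partial_isometry A (prod_word A (map2 v I J))"
  using IJ
proof (induction I J rule: list_induct2)
  case Nil
  show ?case
    by (simp add: partial_isometry_def)
next
  case (Cons i I j J)
  let ?R = "{1..N}"
  note [simp] = matrix_entry_closed[OF v]
  have ij: "i \<in> ?R" "j \<in> ?R" and IJ: "set I \<subseteq> ?R" "set J \<subseteq> ?R"
    using Cons.prems by auto
  have "enat (length I) \<le> enat (length (i # I))"
    by simp
  then have "enat (length I) \<le> L"
    using Cons.prems(1) by (rule order_trans)
  define w where "w = prod_word A (map2 v I J)"
  have w: "partial_isometry A w"
    unfolding w_def by (rule Cons.IH) fact+
  note wD = partial_isometryD[OF w]
  define P where "P = w \<otimes> star A w"
  define Q where "Q t = star A (v i t) \<otimes> v i t" for t
  have P: "P \<in> carrier A" "star A P = P"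
    using wD by (simp_all add: P_def star_mult)
  have Q: "Q t \<in> carrier A" "star A (Q t) = Q t" if "t \<in> ?R" for t
    using that ij by (simp_all add: Q_def star_mult)
  have rel: "word_relation N A (Suc (length I)) v (conj_matrix A v)"
    using H Cons.prems(1) by (simp add: H_relations_def)
  have QPQ: "Q j \<otimes> P \<otimes> Q t = \<zero>" if t: "t \<in> ?R" "t \<noteq> j" for t
  proof -
    have [simp]: "v i j \<in> carrier A" "v i t \<in> carrier A" "w \<in> carrier A"
      using ij t wD by simp_all
    \<comment> \<open>The relation is taken for two words with the same row indices whose column
      indices differ only in the first letter, so both have the tail \<open>w\<close>.\<close>
    have "prod_word A (map2 v (i # I) (j # J) @ rev (map2 (conj_matrix A v) (i # I) (t # J))) = \<zero>"
      using rel[unfolded word_relation_iff, rule_format, of "i # I" "j # J" "i # I" "t # J"]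
        Cons.hyps Cons.prems t by simp
    then have "prod_word A (map2 v (i # I) (j # J)) \<otimes> star A (prod_word A (map2 v (i # I) (t # J))) = \<zero>"
      using word_times_rev_conj_word[OF v, of "i # I" "j # J" "i # I" "t # J"] Cons.prems t
      by simp
    then have 0: "v i j \<otimes> w \<otimes> (star A w \<otimes> star A (v i t)) = \<zero>"
      by (simp add: star_mult flip: w_def)
    have "Q j \<otimes> P \<otimes> Q t = star A (v i j) \<otimes> (v i j \<otimes> w \<otimes> (star A w \<otimes> star A (v i t))) \<otimes> v i t"
      by (simp add: Q_def P_def m_assoc)
    then show ?thesis
      using 0 by simp
  qed
  have *: "Q j \<otimes> P \<otimes> Q j = Q j \<otimes> P"
    using sum_one_absorb_right[of ?R j Q "Q j \<otimes> P"] q[OF ij(1)] ij Q P QPQ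
    by (auto simp: Q_def)
  have "star A (Q j \<otimes> P \<otimes> Q j) = star A (Q j \<otimes> P)"
    by (rule arg_cong[OF *])
  then have "Q j \<otimes> P \<otimes> Q j = P \<otimes> Q j"
    using Q[OF ij(2)] P by (simp add: star_mult m_assoc)
  with * have "Q j \<otimes> P = P \<otimes> Q j"
    by simp
  then have "partial_isometry A (v i j \<otimes> w)"
    by (intro partial_isometry_mult pi ij w) (simp add: P_def Q_def)
  then show ?case
    by (simp add: w_def)
qed

text \<open>Unitarity of \<open>v\<close> and of its conjugate provides all row and column sums. The
  relation for one black letter gives \<open>v\<^sub>i\<^sub>k\<^sup>* v\<^sub>i\<^sub>j = 0\<close>
  for \<open>k \<noteq> j\<close>; multiplying \<open>v\<^sub>i\<^sub>j\<close> on the left by the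
  sum of the \<open>v\<^sub>i\<^sub>k v\<^sub>i\<^sub>k\<^sup>*\<close> over \<open>k\<close> then
  shows that it is a partial isometry.\<close>

lemma H_relations_imp_G_relations:
  assumes "N \<ge> 1" "L \<ge> 1" and v: "matrix_in N A v" and H: "H_relations N L A v"
  shows "G_relations N all_ones L A v"
proof -
  let ?R = "{1..N}"
  note vc [simp] = matrix_entry_closed[OF v]
  have U: "unitary_matrix N A v" and Uc: "unitary_matrix N A (conj_matrix A v)"
    using H by (simp_all add: H_relations_def)
  have sums: "(\<Oplus>k\<in>?R. v i k \<otimes> star A (v i k)) = \<one>" "(\<Oplus>k\<in>?R. star A (v k i) \<otimes> v k i) = \<one>"
    if i: "i \<in> ?R" for i
    using U i by (simp_all add: unitary_matrix_def)
  have sums_conj: "(\<Oplus>k\<in>?R. star A (v i k) \<otimes> v i k) = \<one>" "(\<Oplus>k\<in>?R. v k i \<otimes> star A (v k i)) = \<one>"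
    if i: "i \<in> ?R" for i
  proof -
    have "(\<Oplus>k\<in>?R. star A (v i k) \<otimes> v i k) = (\<Oplus>k\<in>?R. star A (v i k) \<otimes> star A (star A (v i k)))"
      "(\<Oplus>k\<in>?R. v k i \<otimes> star A (v k i)) = (\<Oplus>k\<in>?R. star A (star A (v k i)) \<otimes> star A (v k i))"
      using i by (auto intro!: finsum_cong')
    then show "(\<Oplus>k\<in>?R. star A (v i k) \<otimes> v i k) = \<one>" "(\<Oplus>k\<in>?R. v k i \<otimes> star A (v k i)) = \<one>"
      using Uc i by (simp_all add: unitary_matrix_def conj_matrix_def)
  qed
  have "enat 1 \<le> L"
    using \<open>L \<ge> 1\<close> by (simp add: one_enat_def)
  then have rel: "word_relation N A 1 (conj_matrix A v) v"
    using H unfolding H_relations_def by blast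
  have orth: "star A (v i k) \<otimes> v i j = \<zero>" if "i \<in> ?R" "j \<in> ?R" "k \<in> ?R" "k \<noteq> j" for i j k
    using rel[unfolded word_relation_iff, rule_format, of "[i]" "[k]" "[i]" "[j]"] that
    by (simp add: conj_matrix_def)
  have pi: "partial_isometry A (v i j)" if ij: "i \<in> ?R" "j \<in> ?R" for i j
  proof -
    have "v i j \<otimes> star A (v i j) \<otimes> v i j = v i j"
    proof (rule sum_one_absorb_left[where S = ?R and q = "\<lambda>k. v i k \<otimes> star A (v i k)"])
      show "v i t \<otimes> star A (v i t) \<otimes> v i j = \<zero>" if "t \<in> ?R" "t \<noteq> j" for t
        using that ij orth[OF ij that] by (simp add: m_assoc)
    qed (use ij sums in auto)
    then show ?thesis
      using ij by (simp add: partial_isometry_def)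
  qed
  have magic: "magic_unitary N A (range_proj A v)" "magic_unitary N A (source_proj A v)"
    using sums sums_conj partial_isometryD(4,5)[OF pi]
    by (auto simp: magic_unitary_def range_proj_def source_proj_def)
  have preserves: "preserves_vector N A p \<omega>"
    if p: "magic_unitary N A p" and \<omega>: "perron_frobenius_vector N all_ones \<omega>" for p \<omega>
    unfolding preserves_vector_def
  proof
    fix i assume i: "i \<in> ?R"
    have pc: "p i j \<in> carrier A" if "j \<in> ?R" for j
      using p i that projectionD(1) by (auto simp: magic_unitary_def)
    have "(\<Oplus>j\<in>?R. complex_of_real (\<omega> j) \<odot> p i j) = (\<Oplus>j\<in>?R. complex_of_real (\<omega> i) \<odot> p i j)"
      using pc perron_frobenius_all_ones[OF \<omega> i] by (intro finsum_cong') auto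
    also have "\<dots> = complex_of_real (\<omega> i) \<odot> (\<Oplus>j\<in>?R. p i j)"
      using pc by (intro smult_finsum) auto
    finally show "(\<Oplus>j\<in>?R. complex_of_real (\<omega> j) \<odot> p i j) = complex_of_real (\<omega> i) \<odot> \<one>"
      using p i by (simp add: magic_unitary_def)
  qed
  \<comment> \<open>For the all-ones matrix, the two sides of (II) are a column sum of
    \<open>p\<close> and a row sum of \<open>q\<close>, both equal to the unit.\<close>
  have ones: "(\<Oplus>k\<in>?R. complex_of_real (all_ones i k) \<odot> range_proj A v k j) = \<one>"
    "(\<Oplus>k\<in>?R. complex_of_real (all_ones k j) \<odot> source_proj A v i k) = \<one>"
    if ij: "i \<in> ?R" "j \<in> ?R" for i j
  proof -
    have "(\<Oplus>k\<in>?R. complex_of_real (all_ones i k) \<odot> range_proj A v k j) = (\<Oplus>k\<in>?R. range_proj A v k j)"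
      "(\<Oplus>k\<in>?R. complex_of_real (all_ones k j) \<odot> source_proj A v i k) = (\<Oplus>k\<in>?R. source_proj A v i k)"
      using ij by (auto intro!: finsum_cong' simp: all_ones_def smult_one range_proj_def source_proj_def)
    then show "(\<Oplus>k\<in>?R. complex_of_real (all_ones i k) \<odot> range_proj A v k j) = \<one>"
      "(\<Oplus>k\<in>?R. complex_of_real (all_ones k j) \<odot> source_proj A v i k) = \<one>"
      using magic ij by (simp_all add: magic_unitary_def)
  qed
  show ?thesis
    unfolding G_relations_def Let_def
    using pi magic preserves[OF magic(1)] preserves[OF magic(2)]
      H_relations_imp_word_partial_isometry[OF v H pi sums_conj(1)]
    by (intro conjI) (auto simp only: ones)
qed

end

section \<open>Universal algebras and tensor products\<close>

lemma star_homD: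
  assumes "star_hom A B \<phi>"
  shows "\<phi> \<in> ring_hom A B" "x \<in> carrier A \<Longrightarrow> \<phi> x \<in> carrier B"
    "x \<in> carrier A \<Longrightarrow> y \<in> carrier A \<Longrightarrow> \<phi> (x \<otimes>\<^bsub>A\<^esub> y) = \<phi> x \<otimes>\<^bsub>B\<^esub> \<phi> y"
    "x \<in> carrier A \<Longrightarrow> y \<in> carrier A \<Longrightarrow> \<phi> (x \<oplus>\<^bsub>A\<^esub> y) = \<phi> x \<oplus>\<^bsub>B\<^esub> \<phi> y"
    "\<phi> \<one>\<^bsub>A\<^esub> = \<one>\<^bsub>B\<^esub>"
    "x \<in> carrier A \<Longrightarrow> \<phi> (c \<odot>\<^bsub>A\<^esub> x) = c \<odot>\<^bsub>B\<^esub> \<phi> x"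
    "x \<in> carrier A \<Longrightarrow> \<phi> (star A x) = star B (\<phi> x)"
  using assms by (auto simp: star_hom_def ring_hom_closed ring_hom_mult ring_hom_add ring_hom_one)

lemma star_homI:
  assumes "\<And>x. x \<in> carrier A \<Longrightarrow> \<phi> x \<in> carrier B"
    "\<And>x y. x \<in> carrier A \<Longrightarrow> y \<in> carrier A \<Longrightarrow> \<phi> (x \<otimes>\<^bsub>A\<^esub> y) = \<phi> x \<otimes>\<^bsub>B\<^esub> \<phi> y"
    "\<And>x y. x \<in> carrier A \<Longrightarrow> y \<in> carrier A \<Longrightarrow> \<phi> (x \<oplus>\<^bsub>A\<^esub> y) = \<phi> x \<oplus>\<^bsub>B\<^esub> \<phi> y"
    "\<phi> \<one>\<^bsub>A\<^esub> = \<one>\<^bsub>B\<^esub>"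
    "\<And>c x. x \<in> carrier A \<Longrightarrow> \<phi> (c \<odot>\<^bsub>A\<^esub> x) = c \<odot>\<^bsub>B\<^esub> \<phi> x"
    "\<And>x. x \<in> carrier A \<Longrightarrow> \<phi> (star A x) = star B (\<phi> x)"
  shows "star_hom A B \<phi>"
  using assms by (auto simp: star_hom_def intro: ring_hom_memI)

lemma star_hom_compose:
  "star_hom A B \<phi> \<Longrightarrow> star_hom B C \<psi> \<Longrightarrow> star_hom A C (\<lambda>x. \<psi> (\<phi> x))"
  by (intro star_homI) (simp_all add: star_homD)

lemma star_hom_id: "star_hom A A (\<lambda>x. x)"
  by (intro star_homI) simp_all

lemma star_hom_zero:
  assumes "unital_cstar_algebra A" "unital_cstar_algebra B" "star_hom A B \<phi>"
  shows "\<phi> \<zero>\<^bsub>A\<^esub> = \<zero>\<^bsub>B\<^esub>"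
proof -
  interpret A: unital_cstar_algebra A by fact
  interpret B: unital_cstar_algebra B by fact
  have "\<phi> (0 \<odot>\<^bsub>A\<^esub> \<zero>\<^bsub>A\<^esub>) = 0 \<odot>\<^bsub>B\<^esub> \<phi> \<zero>\<^bsub>A\<^esub>"
    by (rule star_homD(6)[OF assms(3)]) simp
  then show ?thesis
    using star_homD(2)[OF assms(3), of "\<zero>\<^bsub>A\<^esub>"] by simp
qed

lemma star_hom_finsum:
  assumes "unital_cstar_algebra A" "unital_cstar_algebra B" and \<phi>: "star_hom A B \<phi>"
    and "finite S" "\<And>k. k \<in> S \<Longrightarrow> f k \<in> carrier A"
  shows "\<phi> (\<Oplus>\<^bsub>A\<^esub>k\<in>S. f k) = (\<Oplus>\<^bsub>B\<^esub>k\<in>S. \<phi> (f k))"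
proof -
  interpret A: unital_cstar_algebra A by fact
  interpret B: unital_cstar_algebra B by fact
  show ?thesis
    using assms(4,5)
  proof (induction S rule: finite_induct)
    case empty
    then show ?case
      using star_hom_zero[OF assms(1-3)] by simp
  next
    case (insert k S)
    then have "f \<in> S \<rightarrow> carrier A" "(\<lambda>k. \<phi> (f k)) \<in> S \<rightarrow> carrier B"
      by (auto simp: star_homD[OF \<phi>])
    then show ?case
      using insert by (simp add: star_homD[OF \<phi>])
  qed
qed

lemma star_hom_prod_word:
  assumes "unital_cstar_algebra A" and \<phi>: "star_hom A B \<phi>" and "set xs \<subseteq> carrier A"
  shows "\<phi> (prod_word A xs) = prod_word B (map \<phi> xs)"
proof -
  interpret A: unital_cstar_algebra A by fact
  show ?thesis
    using assms(3) by (induction xs) (auto simp: star_homD[OF \<phi>] prod_word_def[of B])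
qed

text \<open>The relations are equations between star polynomials in the entries, so they pass to
  images. This makes the uniqueness part of the universal property available for maps into the
  tensor square.\<close>

lemma H_relations_star_hom:
  assumes A: "unital_cstar_algebra A" and B: "unital_cstar_algebra B" and \<phi>: "star_hom A B \<phi>"
    and v: "matrix_in N A v" and H: "H_relations N L A v"
  shows "H_relations N L B (\<lambda>i j. \<phi> (v i j))"
proof -
  interpret A: unital_cstar_algebra A by fact
  interpret B: unital_cstar_algebra B by fact
  note hom = star_homD[OF \<phi>]
  note zero = star_hom_zero[OF A B \<phi>]
  \<comment> \<open>The image matrix \<open>x'\<close> is prescribed only on the index range,
    because the conjugate of the image is known to be the image of the conjugate only there.\<close>
  have unitary: "unitary_matrix N B x'"
    if x: "matrix_in N A x" and U: "unitary_matrix N A x"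
      and x': "\<And>i j. i \<in> {1..N} \<Longrightarrow> j \<in> {1..N} \<Longrightarrow> x' i j = \<phi> (x i j)" for x x'
    unfolding unitary_matrix_def
  proof (intro ballI conjI)
    fix i j assume ij: "i \<in> {1..N}" "j \<in> {1..N}"
    note xc = A.matrix_entry_closed[OF x]
    have UA: "(\<Oplus>\<^bsub>A\<^esub>k\<in>{1..N}. x i k \<otimes>\<^bsub>A\<^esub> star A (x j k)) = (if i = j then \<one>\<^bsub>A\<^esub> else \<zero>\<^bsub>A\<^esub>)"
      "(\<Oplus>\<^bsub>A\<^esub>k\<in>{1..N}. star A (x k i) \<otimes>\<^bsub>A\<^esub> x k j) = (if i = j then \<one>\<^bsub>A\<^esub> else \<zero>\<^bsub>A\<^esub>)"
      using U ij unfolding unitary_matrix_def by blast+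
    have if_hom: "\<phi> (if i = j then \<one>\<^bsub>A\<^esub> else \<zero>\<^bsub>A\<^esub>) = (if i = j then \<one>\<^bsub>B\<^esub> else \<zero>\<^bsub>B\<^esub>)"
      by (simp add: hom(5) zero)
    have "(\<Oplus>\<^bsub>B\<^esub>k\<in>{1..N}. x' i k \<otimes>\<^bsub>B\<^esub> star B (x' j k)) =
        (\<Oplus>\<^bsub>B\<^esub>k\<in>{1..N}. \<phi> (x i k \<otimes>\<^bsub>A\<^esub> star A (x j k)))"
      using ij xc by (intro B.finsum_cong') (auto simp: hom x')
    also have "\<dots> = \<phi> (\<Oplus>\<^bsub>A\<^esub>k\<in>{1..N}. x i k \<otimes>\<^bsub>A\<^esub> star A (x j k))"
      by (rule star_hom_finsum[OF A B \<phi>, symmetric]) (use ij xc in auto)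
    finally show "(\<Oplus>\<^bsub>B\<^esub>k\<in>{1..N}. x' i k \<otimes>\<^bsub>B\<^esub> star B (x' j k)) =
        (if i = j then \<one>\<^bsub>B\<^esub> else \<zero>\<^bsub>B\<^esub>)"
      unfolding UA if_hom .
    have "(\<Oplus>\<^bsub>B\<^esub>k\<in>{1..N}. star B (x' k i) \<otimes>\<^bsub>B\<^esub> x' k j) =
        (\<Oplus>\<^bsub>B\<^esub>k\<in>{1..N}. \<phi> (star A (x k i) \<otimes>\<^bsub>A\<^esub> x k j))"
      using ij xc by (intro B.finsum_cong') (auto simp: hom x')
    also have "\<dots> = \<phi> (\<Oplus>\<^bsub>A\<^esub>k\<in>{1..N}. star A (x k i) \<otimes>\<^bsub>A\<^esub> x k j)"
      by (rule star_hom_finsum[OF A B \<phi>, symmetric]) (use ij xc in auto)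
    finally show "(\<Oplus>\<^bsub>B\<^esub>k\<in>{1..N}. star B (x' k i) \<otimes>\<^bsub>B\<^esub> x' k j) =
        (if i = j then \<one>\<^bsub>B\<^esub> else \<zero>\<^bsub>B\<^esub>)"
      unfolding UA if_hom .
  qed
  have map_word: "map \<phi> (map2 x I J) = map2 x' I J"
    if "\<And>i j. i \<in> {1..N} \<Longrightarrow> j \<in> {1..N} \<Longrightarrow> x' i j = \<phi> (x i j)" "set I \<subseteq> {1..N}" "set J \<subseteq> {1..N}"
    for x x' I J
    unfolding map_map2 using that
    by (intro map_cong refl) (auto simp: subset_iff elim!: in_set_zipE)
  have word: "word_relation N B k x' y'"
    if x: "matrix_in N A x" and y: "matrix_in N A y" and R: "word_relation N A k x y"
      and x': "\<And>i j. i \<in> {1..N} \<Longrightarrow> j \<in> {1..N} \<Longrightarrow> x' i j = \<phi> (x i j)"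
      and y': "\<And>i j. i \<in> {1..N} \<Longrightarrow> j \<in> {1..N} \<Longrightarrow> y' i j = \<phi> (y i j)" for x y x' y' k
    unfolding word_relation_iff
  proof (intro allI impI, elim conjE)
    fix I J S T
    assume IJ: "length I = k" "length J = k" "length S = k" "length T = k"
      "set I \<subseteq> {1..N}" "set J \<subseteq> {1..N}" "set S \<subseteq> {1..N}" "set T \<subseteq> {1..N}" "(I = S) \<noteq> (J = T)"
    have "map \<phi> (map2 x I J) = map2 x' I J"
      by (rule map_word) (use x' IJ in auto)
    moreover have "map \<phi> (map2 y S T) = map2 y' S T"
      by (rule map_word) (use y' IJ in auto)
    ultimately have "map2 x' I J @ rev (map2 y' S T) = map \<phi> (map2 x I J @ rev (map2 y S T))"
      by (simp only: map_append flip: rev_map)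
    also have "prod_word B \<dots> = \<phi> (prod_word A (map2 x I J @ rev (map2 y S T)))"
      using A.word_closed(1)[OF x IJ(5,6)] A.word_closed(1)[OF y IJ(7,8)]
      by (intro star_hom_prod_word[OF A \<phi>, symmetric]) simp
    also have "prod_word A (map2 x I J @ rev (map2 y S T)) = \<zero>\<^bsub>A\<^esub>"
      using R IJ unfolding word_relation_iff by blast
    finally show "prod_word B (map2 x' I J @ rev (map2 y' S T)) = \<zero>\<^bsub>B\<^esub>"
      using zero by simp
  qed
  have conj: "conj_matrix B (\<lambda>i j. \<phi> (v i j)) i j = \<phi> (conj_matrix A v i j)"
    if "i \<in> {1..N}" "j \<in> {1..N}" for i j
    using that A.matrix_entry_closed[OF v] by (simp add: conj_matrix_def hom)
  note vc = A.matrix_in_conj[OF v]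
  show ?thesis
    unfolding H_relations_def
  proof (intro conjI allI impI)
    show "unitary_matrix N B (\<lambda>i j. \<phi> (v i j))"
      using H by (intro unitary[OF v]) (simp_all add: H_relations_def)
    show "unitary_matrix N B (conj_matrix B (\<lambda>i j. \<phi> (v i j)))"
      using H by (intro unitary[OF vc _ conj]) (simp_all add: H_relations_def)
    fix k :: nat assume k: "1 \<le> k" "enat k \<le> L"
    show "word_relation N B k (\<lambda>i j. \<phi> (v i j)) (conj_matrix B (\<lambda>i j. \<phi> (v i j)))"
      using H k by (intro word[OF v vc _ refl conj]) (simp_all add: H_relations_def)
    show "word_relation N B k (conj_matrix B (\<lambda>i j. \<phi> (v i j))) (\<lambda>i j. \<phi> (v i j))"
      using H k by (intro word[OF vc v _ conj refl]) (simp_all add: H_relations_def)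
  qed
qed

section \<open>Consequences of the universal property\<close>

lemma universal_cstarD:
  assumes "universal_cstar N R A u"
  shows "unital_cstar_algebra A" "matrix_in N A u" "R A u"
  using assms by (simp_all add: universal_cstar_def)

lemma universal_cstar_lift:
  assumes "universal_cstar N R A u" "unital_cstar_algebra B" "matrix_in N B w" "R B w"
  obtains \<phi> where "star_hom A B \<phi>" "\<And>i j. i \<in> {1..N} \<Longrightarrow> j \<in> {1..N} \<Longrightarrow> \<phi> (u i j) = w i j"
  using assms unfolding universal_cstar_def by metis

lemma universal_cstar_unique:
  assumes U: "universal_cstar N R A u" and B: "unital_cstar_algebra B" "matrix_in N B w" "R B w"
    and \<phi>: "star_hom A B \<phi>" "\<And>i j. i \<in> {1..N} \<Longrightarrow> j \<in> {1..N} \<Longrightarrow> \<phi> (u i j) = w i j"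
    and \<psi>: "star_hom A B \<psi>" "\<And>i j. i \<in> {1..N} \<Longrightarrow> j \<in> {1..N} \<Longrightarrow> \<psi> (u i j) = w i j"
    and x: "x \<in> carrier A"
  shows "\<phi> x = \<psi> x"
proof -
  obtain \<theta> where "\<And>\<psi>. star_hom A B \<psi> \<and> (\<forall>i\<in>{1..N}. \<forall>j\<in>{1..N}. \<psi> (u i j) = w i j) \<Longrightarrow> \<psi> x = \<theta> x"
    using U B x unfolding universal_cstar_def by metis
  from this[of \<phi>] this[of \<psi>] show ?thesis
    using \<phi> \<psi> by simp
qed

text \<open>Each algebra satisfies the relations of the other, which gives homomorphisms in both
  directions. Their composites fix the generators and are identities by uniqueness. The inverse is
  kept for moving tensor products.\<close>

lemma universal_cstar_iso:
  assumes A: "universal_cstar N R A u" and B: "universal_cstar N R' B v"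
    and eq: "\<And>C w. unital_cstar_algebra C \<Longrightarrow> matrix_in N C w \<Longrightarrow> R C w \<longleftrightarrow> R' C w"
  obtains \<phi> \<psi> where "star_hom A B \<phi>" "star_hom B A \<psi>"
    "\<And>i j. i \<in> {1..N} \<Longrightarrow> j \<in> {1..N} \<Longrightarrow> \<phi> (u i j) = v i j"
    "\<And>x. x \<in> carrier A \<Longrightarrow> \<psi> (\<phi> x) = x" "\<And>y. y \<in> carrier B \<Longrightarrow> \<phi> (\<psi> y) = y"
proof -
  note AD = universal_cstarD[OF A] and BD = universal_cstarD[OF B]
  have R: "R B v" and R': "R' A u"
    using eq AD BD by auto
  obtain \<phi> where \<phi>: "star_hom A B \<phi>" "\<And>i j. i \<in> {1..N} \<Longrightarrow> j \<in> {1..N} \<Longrightarrow> \<phi> (u i j) = v i j"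
    using universal_cstar_lift[of N R A u B v, OF A BD(1,2) R] by blast
  obtain \<psi> where \<psi>: "star_hom B A \<psi>" "\<And>i j. i \<in> {1..N} \<Longrightarrow> j \<in> {1..N} \<Longrightarrow> \<psi> (v i j) = u i j"
    using universal_cstar_lift[of N R' B v A u, OF B AD(1,2) R'] by blast
  show ?thesis
  proof (rule that[OF \<phi>(1) \<psi>(1) \<phi>(2)])
    show "\<psi> (\<phi> x) = x" if "x \<in> carrier A" for x
      by (rule universal_cstar_unique[OF A AD star_hom_compose[OF \<phi>(1) \<psi>(1)] _ star_hom_id _ that])
        (simp_all add: \<phi> \<psi>)
    show "\<phi> (\<psi> y) = y" if "y \<in> carrier B" for y
      by (rule universal_cstar_unique[OF B BD star_hom_compose[OF \<psi>(1) \<phi>(1)] _ star_hom_id _ that])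
        (simp_all add: \<phi> \<psi>)
  qed
qed

text \<open>A tensor square of \<open>A\<close> is regarded as a tensor square of \<open>B\<close>,
  so that it can be compared with the minimal tensor square of \<open>B\<close>.\<close>

lemma cstar_tensor_transport:
  assumes AB: "unital_cstar_algebra A" "unital_cstar_algebra B"
    and \<phi>: "star_hom A B \<phi>" and \<psi>: "star_hom B A \<psi>"
    and inv: "\<And>x. x \<in> carrier A \<Longrightarrow> \<psi> (\<phi> x) = x" "\<And>y. y \<in> carrier B \<Longrightarrow> \<phi> (\<psi> y) = y"
    and T: "cstar_tensor A A T \<iota> \<kappa>"
  shows "cstar_tensor B B T (\<lambda>y. \<iota> (\<psi> y)) (\<lambda>y. \<kappa> (\<psi> y))"
proof -
  interpret A: unital_cstar_algebra A by fact
  interpret B: unital_cstar_algebra B by fact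
  note hom = star_homD[OF \<psi>] and hom' = star_homD[OF \<phi>]
  note cstar_tensorD = T[unfolded cstar_tensor_def, THEN conjunct2, THEN conjunct2]
  have T_alg: "unital_cstar_algebra T"
    by (rule T[unfolded cstar_tensor_def, THEN conjunct1])
  have \<iota>: "star_hom A T \<iota>"
    by (rule T[unfolded cstar_tensor_def, THEN conjunct2, THEN conjunct1])
  have \<kappa>: "star_hom A T \<kappa>"
    by (rule cstar_tensorD[THEN conjunct1])
  interpret T: unital_cstar_algebra T by (fact T_alg)
  have tensor_comm: "\<forall>a\<in>carrier A. \<forall>b\<in>carrier A. \<iota> a \<otimes>\<^bsub>T\<^esub> \<kappa> b = \<kappa> b \<otimes>\<^bsub>T\<^esub> \<iota> a"
    by (rule cstar_tensorD[THEN conjunct2, THEN conjunct1])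
  have "\<forall>(n::nat) a b. (\<forall>k<n. a k \<in> carrier A \<and> b k \<in> carrier A) \<and>
      (\<forall>c. (\<Oplus>\<^bsub>A\<^esub>k\<in>{..<n}. c k \<odot>\<^bsub>A\<^esub> a k) = \<zero>\<^bsub>A\<^esub> \<longrightarrow> (\<forall>k<n. c k = 0)) \<and>
      (\<Oplus>\<^bsub>T\<^esub>k\<in>{..<n}. \<iota> (a k) \<otimes>\<^bsub>T\<^esub> \<kappa> (b k)) = \<zero>\<^bsub>T\<^esub> \<longrightarrow> (\<forall>k<n. b k = \<zero>\<^bsub>A\<^esub>)"
    by (rule cstar_tensorD[THEN conjunct2, THEN conjunct2, THEN conjunct1])
  note tensor_indep = this[rule_format, OF conjI[OF _ conjI]]
  have "\<forall>x\<in>carrier T. \<forall>e>0. \<exists>(n::nat) a b. (\<forall>k<n. a k \<in> carrier A \<and> b k \<in> carrier A) \<and>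
      nrm T (x \<ominus>\<^bsub>T\<^esub> (\<Oplus>\<^bsub>T\<^esub>k\<in>{..<n}. \<iota> (a k) \<otimes>\<^bsub>T\<^esub> \<kappa> (b k))) < e"
    by (rule cstar_tensorD[THEN conjunct2, THEN conjunct2, THEN conjunct2])
  note tensor_dense = this[rule_format]
  have comm: "\<iota> (\<psi> a) \<otimes>\<^bsub>T\<^esub> \<kappa> (\<psi> b) = \<kappa> (\<psi> b) \<otimes>\<^bsub>T\<^esub> \<iota> (\<psi> a)"
    if "a \<in> carrier B" "b \<in> carrier B" for a b
    using tensor_comm hom(2)[OF that(1)] hom(2)[OF that(2)] by simp
  have indep: "b k = \<zero>\<^bsub>B\<^esub>"
    if ab: "\<forall>k<n. a k \<in> carrier B \<and> b k \<in> carrier B"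
      and indep: "\<forall>c. (\<Oplus>\<^bsub>B\<^esub>k\<in>{..<n}. c k \<odot>\<^bsub>B\<^esub> a k) = \<zero>\<^bsub>B\<^esub> \<longrightarrow> (\<forall>k<n. c k = 0)"
      and zero: "(\<Oplus>\<^bsub>T\<^esub>k\<in>{..<n}. \<iota> (\<psi> (a k)) \<otimes>\<^bsub>T\<^esub> \<kappa> (\<psi> (b k))) = \<zero>\<^bsub>T\<^esub>" and k: "k < n"
    for n :: nat and a b k
  proof -
    \<comment> \<open>Linear independence of the left legs is carried from \<open>B\<close> to
      \<open>A\<close> by applying \<open>\<phi>\<close> to a vanishing combination.\<close>
    have "\<forall>k<n. c k = 0" if "(\<Oplus>\<^bsub>A\<^esub>k\<in>{..<n}. c k \<odot>\<^bsub>A\<^esub> \<psi> (a k)) = \<zero>\<^bsub>A\<^esub>" for c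
    proof -
      have "(\<Oplus>\<^bsub>B\<^esub>k\<in>{..<n}. c k \<odot>\<^bsub>B\<^esub> a k) = (\<Oplus>\<^bsub>B\<^esub>k\<in>{..<n}. \<phi> (c k \<odot>\<^bsub>A\<^esub> \<psi> (a k)))"
        using ab by (intro B.finsum_cong') (auto simp: hom hom' inv)
      also have "\<dots> = \<phi> (\<Oplus>\<^bsub>A\<^esub>k\<in>{..<n}. c k \<odot>\<^bsub>A\<^esub> \<psi> (a k))"
        using ab by (intro star_hom_finsum[OF AB \<phi>, symmetric]) (auto simp: hom)
      finally show ?thesis
        using indep that star_hom_zero[OF AB \<phi>] by simp
    qed
    moreover have "\<forall>k<n. \<psi> (a k) \<in> carrier A \<and> \<psi> (b k) \<in> carrier A"
      using ab hom(2) by blast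
    ultimately have "\<psi> (b k) = \<zero>\<^bsub>A\<^esub>"
      using tensor_indep[of n "\<lambda>k. \<psi> (a k)" "\<lambda>k. \<psi> (b k)" k] zero k by simp
    then have "\<phi> (\<psi> (b k)) = \<zero>\<^bsub>B\<^esub>"
      using star_hom_zero[OF AB \<phi>] by simp
    then show ?thesis
      using ab k inv by simp
  qed
  have dense: "\<exists>(n::nat) a b. (\<forall>k<n. a k \<in> carrier B \<and> b k \<in> carrier B) \<and>
      nrm T (x \<ominus>\<^bsub>T\<^esub> (\<Oplus>\<^bsub>T\<^esub>k\<in>{..<n}. \<iota> (\<psi> (a k)) \<otimes>\<^bsub>T\<^esub> \<kappa> (\<psi> (b k)))) < e"
    if "x \<in> carrier T" "e > 0" for x e
  proof -
    from tensor_dense[OF that] obtain n :: nat and a b where ab: "\<forall>k<n. a k \<in> carrier A \<and> b k \<in> carrier A"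
      and le: "nrm T (x \<ominus>\<^bsub>T\<^esub> (\<Oplus>\<^bsub>T\<^esub>k\<in>{..<n}. \<iota> (a k) \<otimes>\<^bsub>T\<^esub> \<kappa> (b k))) < e"
      by (elim exE conjE)
    have "(\<Oplus>\<^bsub>T\<^esub>k\<in>{..<n}. \<iota> (\<psi> (\<phi> (a k))) \<otimes>\<^bsub>T\<^esub> \<kappa> (\<psi> (\<phi> (b k)))) =
        (\<Oplus>\<^bsub>T\<^esub>k\<in>{..<n}. \<iota> (a k) \<otimes>\<^bsub>T\<^esub> \<kappa> (b k))"
      using ab by (intro T.finsum_cong') (auto simp: inv star_homD(2)[OF \<iota>] star_homD(2)[OF \<kappa>])
    then show ?thesis
      using le ab hom'(2)
      by (intro exI[of _ n] exI[of _ "\<lambda>k. \<phi> (a k)"] exI[of _ "\<lambda>k. \<phi> (b k)"]) simp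
  qed
  show ?thesis
    unfolding cstar_tensor_def
  proof (intro conjI)
    show "star_hom B T (\<lambda>y. \<iota> (\<psi> y))" "star_hom B T (\<lambda>y. \<kappa> (\<psi> y))"
      by (rule star_hom_compose[OF \<psi> \<iota>] star_hom_compose[OF \<psi> \<kappa>])+
    show "\<forall>a\<in>carrier B. \<forall>b\<in>carrier B.
        \<iota> (\<psi> a) \<otimes>\<^bsub>T\<^esub> \<kappa> (\<psi> b) = \<kappa> (\<psi> b) \<otimes>\<^bsub>T\<^esub> \<iota> (\<psi> a)"
      by (intro ballI comm)
  qed (rule T_alg | (intro allI impI, elim conjE, (rule indep; assumption)) |
      (intro ballI allI impI, (rule dense; assumption)))+
qed

section \<open>The isomorphism and its compatibility with the coproducts\<close>

theorem proposition5p6: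
  fixes N :: nat and L :: enat
    and A B :: "'a cstar" and u v :: "nat \<Rightarrow> nat \<Rightarrow> 'a"
  assumes "N \<ge> 2" and "L \<ge> 1"
    and "universal_cstar N (G_relations N all_ones L) A u"
    and "universal_cstar N (H_relations N L) B v"
  shows "\<exists>\<phi>. star_iso A B \<phi> \<and> (\<forall>i\<in>{1..N}. \<forall>j\<in>{1..N}. \<phi> (u i j) = v i j) \<and>
    (\<forall>T \<iota> \<kappa> \<Delta> S \<iota>' \<kappa>' \<Delta>'.
       minimal_tensor A A T \<iota> \<kappa> \<and> coproduct N A u T \<iota> \<kappa> \<Delta> \<and>
       minimal_tensor B B S \<iota>' \<kappa>' \<and> coproduct N B v S \<iota>' \<kappa>' \<Delta>' \<longrightarrow>
       (\<exists>\<Phi>. tensor_map A T \<iota> \<kappa> S \<iota>' \<kappa>' \<phi> \<Phi> \<and>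
            (\<forall>x\<in>carrier A. \<Phi> (\<Delta> x) = \<Delta>' (\<phi> x))))"
proof -
  note U = assms(3) and V = assms(4)
  have eq: "G_relations N all_ones L C w \<longleftrightarrow> H_relations N L C w"
    if C: "unital_cstar_algebra C" and w: "matrix_in N C w" for C :: "'a cstar" and w
  proof -
    interpret C: unital_cstar_algebra C by (fact C)
    show ?thesis
      using C.G_relations_imp_H_relations[OF w] C.H_relations_imp_G_relations[OF _ \<open>L \<ge> 1\<close> w] \<open>N \<ge> 2\<close>
      by (auto simp del: One_nat_def)
  qed
  note A = universal_cstarD[OF U] and B = universal_cstarD[OF V]
  obtain \<phi> \<psi> where \<phi>: "star_hom A B \<phi>" and \<psi>: "star_hom B A \<psi>"
    and gen: "\<And>i j. i \<in> {1..N} \<Longrightarrow> j \<in> {1..N} \<Longrightarrow> \<phi> (u i j) = v i j"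
    and inv: "\<And>x. x \<in> carrier A \<Longrightarrow> \<psi> (\<phi> x) = x" "\<And>y. y \<in> carrier B \<Longrightarrow> \<phi> (\<psi> y) = y"
    using universal_cstar_iso[OF U V eq] by blast
  have iso: "star_iso A B \<phi>"
    unfolding star_iso_def using \<phi> \<psi> inv
    by (auto intro!: bij_betwI[where g = \<psi>] simp: star_homD(2))
  have "\<exists>\<Phi>. tensor_map A T \<iota> \<kappa> S \<iota>' \<kappa>' \<phi> \<Phi> \<and> (\<forall>x\<in>carrier A. \<Phi> (\<Delta> x) = \<Delta>' (\<phi> x))"
    if T: "minimal_tensor A A T \<iota> \<kappa>" and \<Delta>: "coproduct N A u T \<iota> \<kappa> \<Delta>"
      and S: "minimal_tensor B B S \<iota>' \<kappa>'" and \<Delta>': "coproduct N B v S \<iota>' \<kappa>' \<Delta>'"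
    for T \<iota> \<kappa> \<Delta> S \<iota>' \<kappa>' \<Delta>'
  proof -
    have tT: "cstar_tensor A A T \<iota> \<kappa>" and tS: "cstar_tensor B B S \<iota>' \<kappa>'"
      using T S unfolding minimal_tensor_def by blast+
    have Ta: "unital_cstar_algebra T" and \<iota>: "star_hom A T \<iota>" and \<kappa>: "star_hom A T \<kappa>"
      by (rule tT[unfolded cstar_tensor_def, THEN conjunct1]
          tT[unfolded cstar_tensor_def, THEN conjunct2, THEN conjunct1]
          tT[unfolded cstar_tensor_def, THEN conjunct2, THEN conjunct2, THEN conjunct1])+
    have Sa: "unital_cstar_algebra S" and \<iota>': "star_hom B S \<iota>'" and \<kappa>': "star_hom B S \<kappa>'"
      by (rule tS[unfolded cstar_tensor_def, THEN conjunct1]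
          tS[unfolded cstar_tensor_def, THEN conjunct2, THEN conjunct1]
          tS[unfolded cstar_tensor_def, THEN conjunct2, THEN conjunct2, THEN conjunct1])+
    interpret T: unital_cstar_algebra T by (fact Ta)
    interpret S: unital_cstar_algebra S by (fact Sa)
    have "cstar_tensor B B T (\<lambda>y. \<iota> (\<psi> y)) (\<lambda>y. \<kappa> (\<psi> y))"
      by (rule cstar_tensor_transport[OF A(1) B(1) \<phi> \<psi> inv tT])
    \<comment> \<open>Minimality of \<open>S\<close> among the tensor squares of \<open>B\<close>
      supplies \<open>\<phi> \<otimes> \<phi>\<close> as a homomorphism on all of
      \<open>T\<close>.\<close>
    from S[unfolded minimal_tensor_def, THEN conjunct2, rule_format, OF this]
    obtain \<Phi> where \<Phi>: "star_hom T S \<Phi>"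
      and \<Phi>\<iota>: "\<forall>y\<in>carrier B. \<Phi> (\<iota> (\<psi> y)) = \<iota>' y"
      and \<Phi>\<kappa>: "\<forall>y\<in>carrier B. \<Phi> (\<kappa> (\<psi> y)) = \<kappa>' y"
      by (elim exE conjE)
    have \<Phi>_tensor: "\<Phi> (\<iota> x \<otimes>\<^bsub>T\<^esub> \<kappa> y) = \<iota>' (\<phi> x) \<otimes>\<^bsub>S\<^esub> \<kappa>' (\<phi> y)"
      if "x \<in> carrier A" "y \<in> carrier A" for x y
      using bspec[OF \<Phi>\<iota>, of "\<phi> x"] bspec[OF \<Phi>\<kappa>, of "\<phi> y"] that inv(1) star_homD(2)[OF \<phi>] star_homD(2)[OF \<iota>]
        star_homD(2)[OF \<kappa>] star_homD(3)[OF \<Phi>] by simp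
    have \<Delta>_hom: "star_hom A T \<Delta>" and \<Delta>'_hom: "star_hom B S \<Delta>'"
      using \<Delta> \<Delta>' by (simp_all add: coproduct_def)
    interpret A: unital_cstar_algebra A by (fact A(1))
    interpret B: unital_cstar_algebra B by (fact B(1))
    let ?w = "\<lambda>i j. \<Delta>' (v i j)"
    have w: "matrix_in N S ?w"
      using B(2) star_homD(2)[OF \<Delta>'_hom] by (simp add: matrix_in_def)
    have "H_relations N L S ?w"
      by (rule H_relations_star_hom[OF B(1) Sa \<Delta>'_hom B(2,3)])
    then have G: "G_relations N all_ones L S ?w"
      using eq[OF Sa w] by simp
    \<comment> \<open>Both composites are homomorphisms from the universal algebra \<open>A\<close>
      to \<open>S\<close> and send \<open>u i j\<close> to \<open>\<Delta>' (v i j)\<close>, so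
      uniqueness applies.\<close>
    have "\<Phi> (\<Delta> x) = \<Delta>' (\<phi> x)" if x: "x \<in> carrier A" for x
    proof (rule universal_cstar_unique[OF U Sa w G star_hom_compose[OF \<Delta>_hom \<Phi>] _
          star_hom_compose[OF \<phi> \<Delta>'_hom] _ x])
      fix i j assume ij: "i \<in> {1..N}" "j \<in> {1..N}"
      note uc = A.matrix_entry_closed[OF A(2)] and vc = B.matrix_entry_closed[OF B(2)]
      have "\<Phi> (\<Delta> (u i j)) = \<Phi> (\<Oplus>\<^bsub>T\<^esub>k\<in>{1..N}. \<iota> (u i k) \<otimes>\<^bsub>T\<^esub> \<kappa> (u k j))"
        using \<Delta> ij by (simp add: coproduct_def)
      also have "\<dots> = (\<Oplus>\<^bsub>S\<^esub>k\<in>{1..N}. \<Phi> (\<iota> (u i k) \<otimes>\<^bsub>T\<^esub> \<kappa> (u k j)))"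
        by (rule star_hom_finsum[OF Ta Sa \<Phi>])
          (use ij uc star_homD(2)[OF \<iota>] star_homD(2)[OF \<kappa>] in auto)
      also have "\<dots> = (\<Oplus>\<^bsub>S\<^esub>k\<in>{1..N}. \<iota>' (v i k) \<otimes>\<^bsub>S\<^esub> \<kappa>' (v k j))"
        using ij by (intro S.finsum_cong')
          (auto simp: \<Phi>_tensor uc vc gen star_homD(2)[OF \<iota>'] star_homD(2)[OF \<kappa>'])
      also have "\<dots> = \<Delta>' (v i j)"
        using \<Delta>' ij by (simp add: coproduct_def)
      finally show "\<Phi> (\<Delta> (u i j)) = \<Delta>' (v i j)" .
      show "\<Delta>' (\<phi> (u i j)) = \<Delta>' (v i j)"
        using gen[OF ij] by simp
    qed
    moreover have "tensor_map A T \<iota> \<kappa> S \<iota>' \<kappa>' \<phi> \<Phi>"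
      unfolding tensor_map_def by (intro conjI ballI \<Phi> \<Phi>_tensor)
    ultimately show ?thesis
      by blast
  qed
  note tensor = this
  show ?thesis
  proof (intro exI conjI)
    show "star_iso A B \<phi>"
      by (fact iso)
    show "\<forall>i\<in>{1..N}. \<forall>j\<in>{1..N}. \<phi> (u i j) = v i j"
      by (intro ballI gen)
  qed (intro allI impI, elim conjE, rule tensor)
qed

end
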